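(* Let $G$ be a connected unimodular 3-dimensional Lie group with Lie algebra $\mathfrak g$, let $\{X_1,X_2,X_3\}$ be a fixed basis of $\mathfrak g$, and let $P\to M$ be a principal $G$-bundle over a 3-manifold $M$. Then there exists a one-to-one correspondence between $G$-invariant sLag $\mathrm{SU}(3)$-structures $(\omega,\psi)$ on $P$ and triples $(e,a,S)$ consisting of a solder 1-form $e=e^kX_k$, a connection 1-form $a=a^kX_k$ and a $G$-equivariant function $S=(S_{ij})$ on $P$ with values in positive-definite symmetric $3\times 3$ real matrices. The correspondence is given by $$\omega=(\det S)^{-1/2}\sum_{i,j}\tilde S_{ij}\,a^i\wedge e^j,\qquad \psi=-(\det S)\,e^{123}+\sum_k e^k\wedge\hat a^k.$$
   Context: All objects are $C^\infty$. $e^{123}=e^1\wedge e^2\wedge e^3$; $\hat a^k=\frac12\sum_{i,j}\epsilon_{kij}a^i\wedge a^j$ with $\epsilon_{ijk}$ the Levi-Civita symbol; $\tilde S=(\det S)S^{-1}$. Repeated indices in $e^kX_k$ and $a^kX_k$ are summed. $G$ is unimodular if $\det\mathrm{Ad}(g)=\pm1$ for all $g\in G$. $\mathrm{SU}(3)$-structures: on $\mathbb{R}^6\cong\mathbb{C}^3$ with $z^k=x^k+\sqrt{-1}y^k$, let $\omega_0=\sum_k dx^k\wedge dy^k$, $\psi_0=\mathrm{Im}(dz^1\wedge dz^2\wedge dz^3)$. An $\mathrm{SU}(3)$-structure on a 6-manifold is a pair $(\omega,\psi)$ of a real 2-form and a real 3-form pointwise isomorphic to $(\omega_0,\psi_0)$.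 A $G$-invariant sLag $\mathrm{SU}(3)$-structure on $P$ is an $\mathrm{SU}(3)$-structure $(\omega,\psi)$ on $P$ with $\omega,\psi$ invariant under the right $G$-action and $\omega|_F=0$, $\psi|_F=0$ on every fiber $F$ of $P\to M$. A solder 1-form is a horizontal $\mathfrak g$-valued 1-form $e=e^kX_k$ on $P$, equivariant for the adjoint action ($R_g^*e=\mathrm{Ad}(g^{-1})e$, where $R_g$ is the right action of $g$ on $P$), with $e^{123}\neq0$ at each point. $G$ acts on positive-definite symmetric matrices by $g\cdot S=\mathrm{Ad}(g)\,S\,{}^t\mathrm{Ad}(g)$, where $\mathrm{Ad}(g)$ is written as a matrix in the basis $\{X_i\}$; equivariance of $S$ means $R_g^*S=g^{-1}\cdot S$.
   Formalization: The structures (ω,ψ) are restricted to those with Re Ω(X_1,X_2,X_3)>0 on fibres (Ω the complex volume form, X_k fundamental fields); without this the claim fails, since (−ω,ψ) is also an invariant sLag SU(3)-structure but comes from no triple. *)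

theory Defs
  imports "HOL-Analysis.Analysis" "HOL-Algebra.Group"
begin

section \<open>Smooth maps between open subsets of Euclidean spaces\<close>

text \<open>Only used on open sets of finite-dimensional spaces, where \<open>Ck_on k\<close> is the
  usual class of \<open>k\<close> times continuously differentiable functions.\<close>

fun Ck_on :: "nat \<Rightarrow> 'a::real_normed_vector set \<Rightarrow> ('a \<Rightarrow> 'b::real_normed_vector) \<Rightarrow> bool" where
  "Ck_on 0 U f \<longleftrightarrow> continuous_on U f"
| "Ck_on (Suc k) U f \<longleftrightarrow>
     (\<forall>x\<in>U. f differentiable (at x)) \<and> (\<forall>v. Ck_on k U (\<lambda>x. frechet_derivative f (at x) v))"

definition smooth_on :: "'a::real_normed_vector set \<Rightarrow> ('a \<Rightarrow> 'b::real_normed_vector) \<Rightarrow> bool" where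
  "smooth_on U f \<longleftrightarrow> (\<forall>k. Ck_on k U f)"


section \<open>Smooth manifolds\<close>

text \<open>A manifold is a (Hausdorff, second countable) type together with an atlas, not necessarily
  maximal, of charts into a Euclidean space. A chart is its domain paired with a map that is
  relevant on that domain only.\<close>

type_synonym ('m, 'e) chart = "'m set \<times> ('m \<Rightarrow> 'e)"

definition chart_inv :: "('m, 'e) chart \<Rightarrow> 'e \<Rightarrow> 'm" where
  "chart_inv c = inv_into (fst c) (snd c)"

definition smooth_atlas ::
    "('m::{t2_space, second_countable_topology}, 'e::euclidean_space) chart set \<Rightarrow> bool" where
  "smooth_atlas A \<longleftrightarrow>
     (\<Union>c\<in>A. fst c) = UNIV \<and>
     (\<forall>c\<in>A. open (fst c) \<and> open (snd c ` fst c) \<and>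
        homeomorphism (fst c) (snd c ` fst c) (snd c) (chart_inv c)) \<and>
     (\<forall>c\<in>A. \<forall>d\<in>A. smooth_on (snd c ` (fst c \<inter> fst d)) (snd d \<circ> chart_inv c))"

definition prod_atlas ::
    "('m, 'e) chart set \<Rightarrow> ('n, 'f) chart set \<Rightarrow> ('m \<times> 'n, 'e \<times> 'f) chart set" where
  "prod_atlas A B = {(fst c \<times> fst d, map_prod (snd c) (snd d)) | c d. c \<in> A \<and> d \<in> B}"

definition model_atlas :: "('e, 'e) chart set" where
  "model_atlas = {(UNIV, id)}"

definition smooth_map_on ::
    "('m::topological_space, 'e::real_normed_vector) chart set \<Rightarrow>
     ('n::topological_space, 'f::real_normed_vector) chart set \<Rightarrow> 'm set \<Rightarrow> ('m \<Rightarrow> 'n) \<Rightarrow> bool" where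
  "smooth_map_on A B W F \<longleftrightarrow> continuous_on W F \<and>
     (\<forall>c\<in>A. \<forall>d\<in>B.
        smooth_on (snd c ` (fst c \<inter> W \<inter> F -` fst d)) (snd d \<circ> F \<circ> chart_inv c))"

abbreviation smooth_map ::
    "('m::topological_space, 'e::real_normed_vector) chart set \<Rightarrow>
     ('n::topological_space, 'f::real_normed_vector) chart set \<Rightarrow> ('m \<Rightarrow> 'n) \<Rightarrow> bool" where
  "smooth_map A B F \<equiv> smooth_map_on A B UNIV F"


section \<open>Tangent vectors and differential forms\<close>

text \<open>As in many developments of manifolds in type theory, the tangent space at \<open>p\<close> is the model
  space itself, through which a tangent vector at \<open>p\<close> is represented by its coordinates in one
  chart \<open>chart_at A p\<close> around \<open>p\<close>, chosen once and for all. Since \<open>chart_at A p\<close> need not depend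
  continuously on \<open>p\<close>, smoothness of forms is expressed through the coordinate vector fields
  \<open>coord_vector A c\<close> of the charts \<open>c\<close> of the atlas.\<close>

definition chart_at :: "('m, 'e) chart set \<Rightarrow> 'm \<Rightarrow> ('m, 'e) chart" where
  "chart_at A p = (SOME c. c \<in> A \<and> p \<in> fst c)"

text \<open>The differential of \<open>F\<close> at \<open>p\<close>, from the tangent space at \<open>p\<close> to that at \<open>F p\<close>.\<close>

definition tangent_map ::
    "('m, 'e::real_normed_vector) chart set \<Rightarrow> ('n, 'f::real_normed_vector) chart set \<Rightarrow>
     ('m \<Rightarrow> 'n) \<Rightarrow> 'm \<Rightarrow> 'e \<Rightarrow> 'f" where
  "tangent_map A B F p =
     frechet_derivative (snd (chart_at B (F p)) \<circ> F \<circ> chart_inv (chart_at A p))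
       (at (snd (chart_at A p) p))"

text \<open>The tangent vector at \<open>p\<close> whose coordinates in the chart \<open>c\<close> are \<open>v\<close>.\<close>

definition coord_vector ::
    "('m, 'e::real_normed_vector) chart set \<Rightarrow> ('m, 'e) chart \<Rightarrow> 'm \<Rightarrow> 'e \<Rightarrow> 'e" where
  "coord_vector A c p =
     frechet_derivative (snd (chart_at A p) \<circ> chart_inv c) (at (snd c p))"

definition one_form ::
    "('m, 'e::real_normed_vector) chart set \<Rightarrow>
     ('m \<Rightarrow> 'e \<Rightarrow> 'b::real_normed_vector) \<Rightarrow> bool" where
  "one_form A \<alpha> \<longleftrightarrow> (\<forall>p. linear (\<alpha> p)) \<and>
     (\<forall>c\<in>A. \<forall>v. smooth_on (snd c ` fst c)
        (\<lambda>x. let p = chart_inv c x in \<alpha> p (coord_vector A c p v)))"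

definition two_form ::
    "('m, 'e::real_normed_vector) chart set \<Rightarrow> ('m \<Rightarrow> 'e \<Rightarrow> 'e \<Rightarrow> real) \<Rightarrow> bool" where
  "two_form A \<omega> \<longleftrightarrow>
     (\<forall>p. (\<forall>v. linear (\<lambda>u. \<omega> p u v)) \<and> (\<forall>u. linear (\<omega> p u)) \<and> (\<forall>u. \<omega> p u u = 0)) \<and>
     (\<forall>c\<in>A. \<forall>u v. smooth_on (snd c ` fst c)
        (\<lambda>x. let p = chart_inv c x in \<omega> p (coord_vector A c p u) (coord_vector A c p v)))"

definition three_form ::
    "('m, 'e::real_normed_vector) chart set \<Rightarrow> ('m \<Rightarrow> 'e \<Rightarrow> 'e \<Rightarrow> 'e \<Rightarrow> real) \<Rightarrow> bool" where
  "three_form A \<psi> \<longleftrightarrow>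
     (\<forall>p. (\<forall>v w. linear (\<lambda>u. \<psi> p u v w)) \<and> (\<forall>u w. linear (\<lambda>v. \<psi> p u v w)) \<and>
          (\<forall>u v. linear (\<psi> p u v)) \<and>
          (\<forall>u v. \<psi> p u u v = 0 \<and> \<psi> p u v u = 0 \<and> \<psi> p v u u = 0)) \<and>
     (\<forall>c\<in>A. \<forall>u v w. smooth_on (snd c ` fst c)
        (\<lambda>x. let p = chart_inv c x in
           \<psi> p (coord_vector A c p u) (coord_vector A c p v) (coord_vector A c p w)))"

text \<open>Wedge products at a point, normalised so that
  \<open>\<alpha>\<^sup>1 \<and> \<dots> \<and> \<alpha>\<^sup>k\<close> evaluated at \<open>v\<^sub>1, \<dots>, v\<^sub>k\<close> is the determinant of the \<open>\<alpha>\<^sup>i(v\<^sub>j)\<close>.\<close>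

definition wedge11 :: "('v \<Rightarrow> 'b::comm_ring) \<Rightarrow> ('v \<Rightarrow> 'b) \<Rightarrow> 'v \<Rightarrow> 'v \<Rightarrow> 'b" where
  "wedge11 \<alpha> \<beta> u v = \<alpha> u * \<beta> v - \<alpha> v * \<beta> u"

definition wedge12 :: "('v \<Rightarrow> 'b::comm_ring) \<Rightarrow> ('v \<Rightarrow> 'v \<Rightarrow> 'b) \<Rightarrow> 'v \<Rightarrow> 'v \<Rightarrow> 'v \<Rightarrow> 'b" where
  "wedge12 \<alpha> \<beta> u v w = \<alpha> u * \<beta> v w - \<alpha> v * \<beta> u w + \<alpha> w * \<beta> u v"

definition wedge111 ::
    "('v \<Rightarrow> 'b::comm_ring) \<Rightarrow> ('v \<Rightarrow> 'b) \<Rightarrow> ('v \<Rightarrow> 'b) \<Rightarrow> 'v \<Rightarrow> 'v \<Rightarrow> 'v \<Rightarrow> 'b" where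
  "wedge111 \<alpha> \<beta> \<gamma> = wedge12 \<alpha> (wedge11 \<beta> \<gamma>)"


section \<open>Lie groups and principal bundles\<close>

definition lie_group ::
    "('g::{t2_space, second_countable_topology}) monoid \<Rightarrow> ('g, 'e::euclidean_space) chart set \<Rightarrow> bool" where
  "lie_group G AG \<longleftrightarrow> group G \<and> carrier G = UNIV \<and> smooth_atlas AG \<and>
     smooth_map (prod_atlas AG AG) AG (\<lambda>(g, h). g \<otimes>\<^bsub>G\<^esub> h) \<and>
     smooth_map AG AG (\<lambda>g. inv\<^bsub>G\<^esub> g)"

text \<open>The Lie algebra is the tangent space at the identity, that is, the type \<open>'e\<close>; its bracket
  is not needed here.\<close>

definition Ad :: "'g monoid \<Rightarrow> ('g, 'e::euclidean_space) chart set \<Rightarrow> 'g \<Rightarrow> 'e \<Rightarrow> 'e" where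
  "Ad G AG g = tangent_map AG AG (\<lambda>h. g \<otimes>\<^bsub>G\<^esub> h \<otimes>\<^bsub>G\<^esub> inv\<^bsub>G\<^esub> g) \<one>\<^bsub>G\<^esub>"

definition unimodular :: "'g monoid \<Rightarrow> ('g, real^'n) chart set \<Rightarrow> bool" where
  "unimodular G AG \<longleftrightarrow> (\<forall>g. det (matrix (Ad G AG g)) = 1 \<or> det (matrix (Ad G AG g)) = - 1)"

definition is_basis :: "('k \<Rightarrow> 'e::real_vector) \<Rightarrow> bool" where
  "is_basis X \<longleftrightarrow> inj X \<and> independent (range X) \<and> span (range X) = UNIV"

text \<open>\<open>component X \<alpha> k p\<close> is \<open>\<alpha>\<^sup>k\<close> at \<open>p\<close>, where \<open>\<alpha> = \<alpha>\<^sup>k X\<^sub>k\<close>.\<close>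

definition component ::
    "('k \<Rightarrow> 'l::real_vector) \<Rightarrow> ('m \<Rightarrow> 'e \<Rightarrow> 'l) \<Rightarrow> 'k \<Rightarrow> 'm \<Rightarrow> 'e \<Rightarrow> real" where
  "component X \<alpha> k p v = representation (range X) (\<alpha> p v) (X k)"

definition Ad_matrix ::
    "'g monoid \<Rightarrow> ('g, 'e::euclidean_space) chart set \<Rightarrow> ('k::finite \<Rightarrow> 'e) \<Rightarrow> 'g \<Rightarrow> real^'k^'k" where
  "Ad_matrix G AG X g = (\<chi> i j. representation (range X) (Ad G AG g (X j)) (X i))"

definition principal_bundle ::
    "'g monoid \<Rightarrow> ('g::{t2_space, second_countable_topology}, 'e::euclidean_space) chart set \<Rightarrow>
     ('p::{t2_space, second_countable_topology}, 'f::euclidean_space) chart set \<Rightarrow>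
     ('m::{t2_space, second_countable_topology}, 'h::euclidean_space) chart set \<Rightarrow>
     ('p \<Rightarrow> 'm) \<Rightarrow> ('p \<Rightarrow> 'g \<Rightarrow> 'p) \<Rightarrow> bool" where
  "principal_bundle G AG AP AM \<pi> act \<longleftrightarrow>
     smooth_atlas AP \<and> smooth_atlas AM \<and> smooth_map AP AM \<pi> \<and>
     smooth_map (prod_atlas AP AG) AP (\<lambda>(p, g). act p g) \<and>
     (\<forall>p. act p \<one>\<^bsub>G\<^esub> = p) \<and>
     (\<forall>p g h. act (act p g) h = act p (g \<otimes>\<^bsub>G\<^esub> h)) \<and>
     (\<forall>p g. \<pi> (act p g) = \<pi> p) \<and>
     (\<forall>m. \<exists>U \<Phi>. open U \<and> m \<in> U \<and> bij_betw \<Phi> (\<pi> -` U) (U \<times> UNIV) \<and>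
        smooth_map_on AP (prod_atlas AM AG) (\<pi> -` U) \<Phi> \<and>
        smooth_map_on (prod_atlas AM AG) AP (U \<times> UNIV) (inv_into (\<pi> -` U) \<Phi>) \<and>
        (\<forall>p\<in>\<pi> -` U. fst (\<Phi> p) = \<pi> p \<and> (\<forall>g. snd (\<Phi> (act p g)) = snd (\<Phi> p) \<otimes>\<^bsub>G\<^esub> g)))"

text \<open>The tangent space at \<open>p\<close> to the fibre through \<open>p\<close>.\<close>

definition vertical ::
    "('p, 'f::real_normed_vector) chart set \<Rightarrow> ('m, 'h::real_normed_vector) chart set \<Rightarrow>
     ('p \<Rightarrow> 'm) \<Rightarrow> 'p \<Rightarrow> 'f set" where
  "vertical AP AM \<pi> p = {u. tangent_map AP AM \<pi> p u = 0}"

definition right_diff ::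
    "('p, 'f::real_normed_vector) chart set \<Rightarrow> ('p \<Rightarrow> 'g \<Rightarrow> 'p) \<Rightarrow> 'g \<Rightarrow> 'p \<Rightarrow> 'f \<Rightarrow> 'f" where
  "right_diff AP act g p = tangent_map AP AP (\<lambda>q. act q g) p"

text \<open>The value at \<open>p\<close> of the fundamental vector field of \<open>\<xi>\<close>.\<close>

definition fundamental ::
    "'g monoid \<Rightarrow> ('g, 'e::real_normed_vector) chart set \<Rightarrow>
     ('p, 'f::real_normed_vector) chart set \<Rightarrow> ('p \<Rightarrow> 'g \<Rightarrow> 'p) \<Rightarrow> 'e \<Rightarrow> 'p \<Rightarrow> 'f" where
  "fundamental G AG AP act \<xi> p = tangent_map AG AP (\<lambda>g. act p g) \<one>\<^bsub>G\<^esub> \<xi>"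

definition Ad_equivariant ::
    "'g monoid \<Rightarrow> ('g, 'e::euclidean_space) chart set \<Rightarrow>
     ('p, 'f::real_normed_vector) chart set \<Rightarrow> ('p \<Rightarrow> 'g \<Rightarrow> 'p) \<Rightarrow> ('p \<Rightarrow> 'f \<Rightarrow> 'e) \<Rightarrow> bool" where
  "Ad_equivariant G AG AP act \<alpha> \<longleftrightarrow>
     (\<forall>g p v. \<alpha> (act p g) (right_diff AP act g p v) = Ad G AG (inv\<^bsub>G\<^esub> g) (\<alpha> p v))"

definition connection_form ::
    "'g monoid \<Rightarrow> ('g, 'e::euclidean_space) chart set \<Rightarrow>
     ('p, 'f::real_normed_vector) chart set \<Rightarrow> ('p \<Rightarrow> 'g \<Rightarrow> 'p) \<Rightarrow> ('p \<Rightarrow> 'f \<Rightarrow> 'e) \<Rightarrow> bool" where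
  "connection_form G AG AP act a \<longleftrightarrow> one_form AP a \<and> Ad_equivariant G AG AP act a \<and>
     (\<forall>p \<xi>. a p (fundamental G AG AP act \<xi> p) = \<xi>)"

definition solder_form ::
    "'g monoid \<Rightarrow> ('g, 'e::euclidean_space) chart set \<Rightarrow>
     ('p, 'f::real_normed_vector) chart set \<Rightarrow> ('m, 'h::real_normed_vector) chart set \<Rightarrow>
     ('p \<Rightarrow> 'm) \<Rightarrow> ('p \<Rightarrow> 'g \<Rightarrow> 'p) \<Rightarrow> (3 \<Rightarrow> 'e) \<Rightarrow> ('p \<Rightarrow> 'f \<Rightarrow> 'e) \<Rightarrow> bool" where
  "solder_form G AG AP AM \<pi> act X e \<longleftrightarrow> one_form AP e \<and> Ad_equivariant G AG AP act e \<and>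
     (\<forall>p. \<forall>u\<in>vertical AP AM \<pi> p. e p u = 0) \<and>
     (\<forall>p. \<exists>u v w.
        wedge111 (component X e 1 p) (component X e 2 p) (component X e 3 p) u v w \<noteq> 0)"

definition posdef :: "real^'n^'n \<Rightarrow> bool" where
  "posdef S \<longleftrightarrow> transpose S = S \<and> (\<forall>x. x \<noteq> 0 \<longrightarrow> x \<bullet> (S *v x) > 0)"

definition equivariant_metric ::
    "'g monoid \<Rightarrow> ('g, 'e::euclidean_space) chart set \<Rightarrow>
     ('p::topological_space, 'f::real_normed_vector) chart set \<Rightarrow> ('p \<Rightarrow> 'g \<Rightarrow> 'p) \<Rightarrow>
     ('k::finite \<Rightarrow> 'e) \<Rightarrow> ('p \<Rightarrow> real^'k^'k) \<Rightarrow> bool" where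
  "equivariant_metric G AG AP act X S \<longleftrightarrow> smooth_map AP model_atlas S \<and> (\<forall>p. posdef (S p)) \<and>
     (\<forall>p g. let A = Ad_matrix G AG X (inv\<^bsub>G\<^esub> g) in S (act p g) = A ** S p ** transpose A)"


section \<open>SU(3)-structures with special Lagrangian fibres\<close>

definition omega0 :: "complex^3 \<Rightarrow> complex^3 \<Rightarrow> real" where
  "omega0 u v = (\<Sum>k\<in>UNIV. wedge11 (\<lambda>z. Re (z $ k)) (\<lambda>z. Im (z $ k)) u v)"

text \<open>\<open>dz\<^sup>1 \<and> dz\<^sup>2 \<and> dz\<^sup>3\<close>\<close>

definition Omega0 :: "complex^3 \<Rightarrow> complex^3 \<Rightarrow> complex^3 \<Rightarrow> complex" where
  "Omega0 = wedge111 (\<lambda>z. z $ 1) (\<lambda>z. z $ 2) (\<lambda>z. z $ 3)"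

definition psi0 :: "complex^3 \<Rightarrow> complex^3 \<Rightarrow> complex^3 \<Rightarrow> real" where
  "psi0 u v w = Im (Omega0 u v w)"

definition adapted_frame ::
    "('p \<Rightarrow> 'f::real_vector \<Rightarrow> 'f \<Rightarrow> real) \<Rightarrow> ('p \<Rightarrow> 'f \<Rightarrow> 'f \<Rightarrow> 'f \<Rightarrow> real) \<Rightarrow> 'p \<Rightarrow>
     ('f \<Rightarrow> complex^3) \<Rightarrow> bool" where
  "adapted_frame \<omega> \<psi> p f \<longleftrightarrow> linear f \<and> bij f \<and>
     (\<forall>u v. \<omega> p u v = omega0 (f u) (f v)) \<and>
     (\<forall>u v w. \<psi> p u v w = psi0 (f u) (f v) (f w))"

definition su3_structure ::
    "('p, real^6) chart set \<Rightarrow> ('p \<Rightarrow> real^6 \<Rightarrow> real^6 \<Rightarrow> real) \<Rightarrow>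
     ('p \<Rightarrow> real^6 \<Rightarrow> real^6 \<Rightarrow> real^6 \<Rightarrow> real) \<Rightarrow> bool" where
  "su3_structure AP \<omega> \<psi> \<longleftrightarrow> two_form AP \<omega> \<and> three_form AP \<psi> \<and>
     (\<forall>p. \<exists>f. adapted_frame \<omega> \<psi> p f)"

definition invariant_slag_structure ::
    "('p, real^6) chart set \<Rightarrow> ('m, 'h::real_normed_vector) chart set \<Rightarrow> ('p \<Rightarrow> 'm) \<Rightarrow>
     ('p \<Rightarrow> 'g \<Rightarrow> 'p) \<Rightarrow> ('p \<Rightarrow> real^6 \<Rightarrow> real^6 \<Rightarrow> real) \<Rightarrow>
     ('p \<Rightarrow> real^6 \<Rightarrow> real^6 \<Rightarrow> real^6 \<Rightarrow> real) \<Rightarrow> bool" where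
  "invariant_slag_structure AP AM \<pi> act \<omega> \<psi> \<longleftrightarrow> su3_structure AP \<omega> \<psi> \<and>
     (\<forall>g p u v. let D = right_diff AP act g p in \<omega> (act p g) (D u) (D v) = \<omega> p u v) \<and>
     (\<forall>g p u v w. let D = right_diff AP act g p in
        \<psi> (act p g) (D u) (D v) (D w) = \<psi> p u v w) \<and>
     (\<forall>p. \<forall>u\<in>vertical AP AM \<pi> p. \<forall>v\<in>vertical AP AM \<pi> p. \<omega> p u v = 0) \<and>
     (\<forall>p. \<forall>u\<in>vertical AP AM \<pi> p. \<forall>v\<in>vertical AP AM \<pi> p. \<forall>w\<in>vertical AP AM \<pi> p. \<psi> p u v w = 0)"

text \<open>On a special Lagrangian fibre the real part of the complex volume form
  \<open>\<Omega> = f\<^sup>*Omega0\<close> (which does not depend on the adapted frame \<open>f\<close>) is a volume form, so a special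
  Lagrangian submanifold is canonically oriented. The basis \<open>X\<close> orients the fibres as well, through
  the fundamental vector fields, and the following condition says that both orientations agree.

  The correspondence with triples \<open>(e, a, S)\<close> needs this convention. The automorphism
  \<open>(x, y) \<mapsto> (-x, y)\<close> of \<open>\<complex>\<^sup>3\<close> pulls \<open>(omega0, psi0)\<close> back to \<open>(-omega0, psi0)\<close>, so if
  \<open>(\<omega>, \<psi>)\<close> is an invariant structure with special Lagrangian fibres, then so is \<open>(-\<omega>, \<psi>)\<close>. But
  contracting \<open>\<psi>\<close> with two fundamental fields recovers \<open>e\<close>, and contracting \<open>\<omega>\<close> with one then
  recovers \<open>(det S)\<^sup>-\<^sup>1\<^sup>/\<^sup>2 S~\<close>; positive definite \<open>S\<close> therefore produces at most one of the two.
  Replacing \<open>X\<close> by \<open>-X\<close> exchanges them.\<close>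

definition fibres_oriented_by ::
    "'g monoid \<Rightarrow> ('g, 'e::real_normed_vector) chart set \<Rightarrow> ('p, 'f::real_normed_vector) chart set \<Rightarrow>
     ('p \<Rightarrow> 'g \<Rightarrow> 'p) \<Rightarrow> (3 \<Rightarrow> 'e) \<Rightarrow>
     ('p \<Rightarrow> 'f \<Rightarrow> 'f \<Rightarrow> real) \<Rightarrow> ('p \<Rightarrow> 'f \<Rightarrow> 'f \<Rightarrow> 'f \<Rightarrow> real) \<Rightarrow> bool" where
  "fibres_oriented_by G AG AP act X \<omega> \<psi> \<longleftrightarrow>
     (\<forall>p. \<exists>f. adapted_frame \<omega> \<psi> p f \<and>
        (let V = (\<lambda>k. f (fundamental G AG AP act (X k) p)) in Re (Omega0 (V 1) (V 2) (V 3)) > 0))"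


section \<open>The forms built from a triple\<close>

text \<open>In the type \<open>3\<close> the numeral \<open>3\<close> is \<open>0\<close>; \<open>1\<close>, \<open>2\<close>, \<open>3\<close> are its distinct elements.\<close>

definition levi_civita :: "3 \<Rightarrow> 3 \<Rightarrow> 3 \<Rightarrow> real" where
  "levi_civita i j k =
     (if (i, j, k) \<in> {(1, 2, 3), (2, 3, 1), (3, 1, 2)} then 1
      else if (i, j, k) \<in> {(1, 3, 2), (3, 2, 1), (2, 1, 3)} then - 1 else 0)"

definition hat :: "(3 \<Rightarrow> 'v \<Rightarrow> real) \<Rightarrow> 3 \<Rightarrow> 'v \<Rightarrow> 'v \<Rightarrow> real" where
  "hat a k u v = (1 / 2) * (\<Sum>i\<in>UNIV. \<Sum>j\<in>UNIV. levi_civita k i j * wedge11 (a i) (a j) u v)"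

definition tilde :: "real^'n^'n \<Rightarrow> real^'n^'n" where
  "tilde S = det S *\<^sub>R matrix_inv S"

definition triple_omega ::
    "(3 \<Rightarrow> 'e::real_vector) \<Rightarrow> ('p \<Rightarrow> 'f \<Rightarrow> 'e) \<Rightarrow> ('p \<Rightarrow> 'f \<Rightarrow> 'e) \<Rightarrow> ('p \<Rightarrow> real^3^3) \<Rightarrow>
     'p \<Rightarrow> 'f \<Rightarrow> 'f \<Rightarrow> real" where
  "triple_omega X e a S p u v = det (S p) powr (- 1 / 2) *
     (\<Sum>i\<in>UNIV. \<Sum>j\<in>UNIV.
        tilde (S p) $ i $ j * wedge11 (component X a i p) (component X e j p) u v)"

definition triple_psi ::
    "(3 \<Rightarrow> 'e::real_vector) \<Rightarrow> ('p \<Rightarrow> 'f \<Rightarrow> 'e) \<Rightarrow> ('p \<Rightarrow> 'f \<Rightarrow> 'e) \<Rightarrow> ('p \<Rightarrow> real^3^3) \<Rightarrow>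
     'p \<Rightarrow> 'f \<Rightarrow> 'f \<Rightarrow> 'f \<Rightarrow> real" where
  "triple_psi X e a S p u v w =
     - det (S p) * wedge111 (component X e 1 p) (component X e 2 p) (component X e 3 p) u v w +
     (\<Sum>k\<in>UNIV. wedge12 (component X e k p) (hat (\<lambda>i. component X a i p) k) u v w)"

end

theory Submission
  imports Defs
begin

text \<open>The correspondence is linear algebra at each point of \<open>P\<close>, made global by uniqueness.

At \<open>p\<close> let \<open>V\<^sub>1, V\<^sub>2, V\<^sub>3\<close> be the fundamental vectors of the basis \<open>X\<close>. There, a triple amounts
to linear maps \<open>a\<close>, \<open>e\<close> into \<open>\<real>\<^sup>3\<close> and a positive definite matrix \<open>S\<close> such that \<open>a(V\<^sub>k)\<close> is the
\<open>k\<close>-th unit vector, \<open>e(V\<^sub>k) = 0\<close>, and \<open>e\<close> is onto (\<open>coframe_triple\<close>).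

From a triple to an \<open>SU(3)\<close>-structure: write the inverse of \<open>S\<close> as \<open>A\<^sup>T A\<close> with \<open>det A > 0\<close>.
Then \<open>x = A a\<close> and \<open>y = A e / det A\<close> are the real and imaginary parts of an adapted frame;
substituting them into \<open>omega0\<close> and \<open>psi0\<close> gives exactly the formulas for \<open>\<omega>\<close> and \<open>\<psi>\<close>
(\<open>coframe_triple_adapted_frame\<close>).

From an \<open>SU(3)\<close>-structure to a triple: let \<open>f\<close> be an adapted frame and \<open>F\<close> the complex matrix
with columns \<open>f(V\<^sub>k)\<close>. The fibre is Lagrangian, so \<open>H = F\<^sup>* F\<close> is real; it is special and
correctly oriented, so \<open>d = det F\<close> is real and positive. The real and imaginary parts of
\<open>F\<^sup>-\<^sup>1 f\<close> are \<open>a\<close> and \<open>e / d\<close> for a triple whose \<open>S\<close> is the inverse of \<open>H\<close>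
(\<open>adapted_frame_coframe_triple\<close>).

Contracting the forms with the \<open>V\<^sub>k\<close> recovers \<open>e\<close> from \<open>\<psi>\<close>, then \<open>S\<close> from \<open>\<omega>\<close>, then \<open>a\<close> from
\<open>\<psi>\<close>, by explicit formulas (\<open>rec_solder\<close>, \<open>rec_metric\<close>, \<open>rec_connection\<close>). They give uniqueness
of the triple at each point (\<open>coframe_triple_unique\<close>), hence injectivity, and also the
smoothness of the triple belonging to smooth forms. Uniqueness moreover turns invariance of the
forms into equivariance of the triple: the right action of \<open>g\<close> carries the fundamental vector of
\<open>X\<^sub>k\<close> at \<open>p\<close> to that of \<open>Ad(g\<^sup>-\<^sup>1) X\<^sub>k\<close> at \<open>p g\<close>, so pulling back the triple at \<open>p g\<close> and
applying \<open>Ad(g)\<close> gives a triple at \<open>p\<close> for the same forms.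

Changing \<open>a\<close> and \<open>e\<close> by a matrix multiplies the mixed part of \<open>\<psi>\<close> by its determinant
(\<open>coframe_change\<close>), so the last step and its converse require \<open>det Ad(g) = 1\<close>. Unimodularity
leaves the two values \<open>1\<close> and \<open>-1\<close>; since \<open>Ad\<close> is continuous and \<open>G\<close> connected, only \<open>1\<close> occurs
(\<open>det_Ad\<close>).\<close>

section \<open>Calculus of smooth functions\<close>

lemma Ck_on_imp_continuous_on: "Ck_on k U f \<Longrightarrow> continuous_on U f"
  by (cases k) (auto intro!: continuous_at_imp_continuous_on differentiable_imp_continuous_within)

lemma Ck_on_Suc_imp: "Ck_on (Suc k) U f \<Longrightarrow> Ck_on k U f"
proof (induction k arbitrary: f)
  case 0
  then show ?case using Ck_on_imp_continuous_on by (metis Ck_on.simps(1))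
next
  case (Suc k)
  then show ?case by (metis Ck_on.simps(2))
qed

lemma Ck_on_cong:
  assumes "open U" "\<And>x. x \<in> U \<Longrightarrow> f x = g x" "Ck_on k U f"
  shows "Ck_on k U g"
  using assms(2,3)
proof (induction k arbitrary: f g)
  case 0
  then show ?case by (metis Ck_on.simps(1) continuous_on_cong)
next
  case (Suc k)
  have d: "(g has_derivative frechet_derivative f (at x)) (at x)" if "x \<in> U" for x
  proof -
    have "(f has_derivative frechet_derivative f (at x)) (at x)"
      using Suc.prems(2) that frechet_derivative_works by auto
    then show ?thesis
      using has_derivative_transform_within_open[OF _ assms(1) that] Suc.prems(1) by blast
  qed
  have "frechet_derivative g (at x) = frechet_derivative f (at x)" if "x \<in> U" for x
    using d[OF that] frechet_derivative_at by metis
  moreover have "g differentiable (at x)" if "x \<in> U" for x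
    using d[OF that] differentiable_def by blast
  ultimately show ?case
    using Suc.IH[of "\<lambda>x. frechet_derivative f (at x) _"] Suc.prems(2) by auto
qed

text \<open>Any explicit derivative may stand in for the one chosen by \<^const>\<open>frechet_derivative\<close>.\<close>

lemma Ck_on_SucI:
  assumes "open U" and "\<And>x. x \<in> U \<Longrightarrow> (f has_derivative f' x) (at x)"
    and "\<And>v. Ck_on k U (\<lambda>x. f' x v)"
  shows "Ck_on (Suc k) U f"
proof -
  have "frechet_derivative f (at x) = f' x" if "x \<in> U" for x
    using assms(2)[OF that] frechet_derivative_at by metis
  then have "Ck_on k U (\<lambda>x. frechet_derivative f (at x) v)" for v
    by (intro Ck_on_cong[OF assms(1) _ assms(3)]) simp
  then show ?thesis using assms(2) by (auto intro: differentiableI)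
qed

lemma Ck_on_SucD:
  assumes "Ck_on (Suc k) U f" "x \<in> U"
  shows "(f has_derivative frechet_derivative f (at x)) (at x)"
  using assms frechet_derivative_works by auto

lemma Ck_on_const: "Ck_on k U (\<lambda>x. c)"
  by (induction k arbitrary: c) auto

lemma Ck_on_bounded_linear_comp:
  assumes "open U" "bounded_linear L" "Ck_on k U f"
  shows "Ck_on k U (\<lambda>x. L (f x))"
  using assms(3)
proof (induction k arbitrary: f)
  case 0
  then show ?case using assms(2) by (auto intro: bounded_linear.continuous_on)
next
  case (Suc k)
  show ?case
  proof (rule Ck_on_SucI[OF assms(1)])
    show "((\<lambda>x. L (f x)) has_derivative (\<lambda>v. L (frechet_derivative f (at x) v))) (at x)"
      if "x \<in> U" for x
      using bounded_linear.has_derivative[OF assms(2) Ck_on_SucD[OF Suc.prems that]] .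
    show "Ck_on k U (\<lambda>x. L (frechet_derivative f (at x) v))" for v
      using Suc by auto
  qed
qed

lemma Ck_on_add:
  assumes "open U" "Ck_on k U f" "Ck_on k U g"
  shows "Ck_on k U (\<lambda>x. f x + g x)"
  using assms(2,3)
proof (induction k arbitrary: f g)
  case 0
  then show ?case by (auto intro: continuous_intros)
next
  case (Suc k)
  show ?case
    by (rule Ck_on_SucI[OF assms(1)
          has_derivative_add[OF Ck_on_SucD[OF Suc.prems(1)] Ck_on_SucD[OF Suc.prems(2)]]])
      (use Suc in auto)
qed

lemma Ck_on_sum:
  assumes "open U" "\<And>i. i \<in> I \<Longrightarrow> Ck_on k U (f i)"
  shows "Ck_on k U (\<lambda>x. \<Sum>i\<in>I. f i x)"
  using assms(2)
  by (induction I rule: infinite_finite_induct) (auto intro: Ck_on_const Ck_on_add[OF assms(1)])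

lemma Ck_on_scaleR:
  fixes f :: "'a::real_normed_vector \<Rightarrow> real"
  assumes "open U" "Ck_on k U f" "Ck_on k U g"
  shows "Ck_on k U (\<lambda>x. f x *\<^sub>R g x)"
  using assms(2,3)
proof (induction k arbitrary: f g)
  case 0
  then show ?case by (auto intro: continuous_intros)
next
  case (Suc k)
  show ?case
  proof (rule Ck_on_SucI[OF assms(1)
          has_derivative_scaleR[OF Ck_on_SucD[OF Suc.prems(1)] Ck_on_SucD[OF Suc.prems(2)]]])
    fix v
    have "Ck_on k U f" "Ck_on k U g" using Suc.prems Ck_on_Suc_imp by blast+
    then show "Ck_on k U (\<lambda>x. f x *\<^sub>R frechet_derivative g (at x) v + frechet_derivative f (at x) v
        *\<^sub>R g x)"
      using Suc.prems Suc.IH by (auto intro!: Ck_on_add[OF assms(1)])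
  qed
qed

text \<open>By the chain rule, \<open>(g \<circ> f)'\<close> is a sum of products of \<open>C\<^sup>k\<close> functions once the derivative of \<open>f\<close>
  is expanded in a basis; this is where the intermediate space has to be Euclidean.\<close>

lemma Ck_on_compose:
  fixes f :: "'a::real_normed_vector \<Rightarrow> 'b::euclidean_space"
    and g :: "'b \<Rightarrow> 'c::real_normed_vector"
  assumes "open U" "f ` U \<subseteq> V" "Ck_on k U f" "Ck_on k V g"
  shows "Ck_on k U (\<lambda>x. g (f x))"
  using assms(3,4)
proof (induction k arbitrary: g)
  case 0
  then show ?case
    using assms(2) continuous_on_compose2[of V g U f] by simp
next
  case (Suc k)
  let ?f' = "\<lambda>x. frechet_derivative f (at x)" and ?g' = "\<lambda>y. frechet_derivative g (at y)"
  have fV: "f x \<in> V" if "x \<in> U" for x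
    using assms(2) that by blast
  have D: "((\<lambda>x. g (f x)) has_derivative (\<lambda>v. ?g' (f x) (?f' x v))) (at x)" if "x \<in> U" for x
    using diff_chain_at[OF Ck_on_SucD[OF Suc.prems(1) that] Ck_on_SucD[OF Suc.prems(2) fV[OF that]]]
    by (simp add: o_def)
  have C: "Ck_on k U (\<lambda>x. ?g' (f x) (?f' x v))" for v
  proof (rule Ck_on_cong[OF assms(1)])
    show "Ck_on k U (\<lambda>x. \<Sum>b\<in>Basis. (?f' x v \<bullet> b) *\<^sub>R ?g' (f x) b)"
    proof (intro Ck_on_sum[OF assms(1)] Ck_on_scaleR[OF assms(1)])
      fix b :: 'b
      show "Ck_on k U (\<lambda>x. ?f' x v \<bullet> b)"
        using Suc.prems(1) by (intro Ck_on_bounded_linear_comp[OF assms(1)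
            bounded_linear_inner_left]) auto
      show "Ck_on k U (\<lambda>x. ?g' (f x) b)"
        using Suc.IH[of "\<lambda>y. ?g' y b"] Suc.prems Ck_on_Suc_imp by auto
    qed
    fix x assume "x \<in> U"
    then have "linear (?g' (f x))"
      using Ck_on_SucD[OF Suc.prems(2) fV] has_derivative_linear by blast
    then have "(\<Sum>b\<in>Basis. (?f' x v \<bullet> b) *\<^sub>R ?g' (f x) b)
        = ?g' (f x) (\<Sum>b\<in>Basis. (?f' x v \<bullet> b) *\<^sub>R b)"
      by (simp add: linear_sum linear_scale)
    then show "(\<Sum>b\<in>Basis. (?f' x v \<bullet> b) *\<^sub>R ?g' (f x) b) = ?g' (f x) (?f' x v)"
      by (simp add: euclidean_representation)
  qed
  show ?case by (rule Ck_on_SucI[OF assms(1) D C])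
qed

lemma Ck_on_powr: "Ck_on k {0<..} (\<lambda>x::real. x powr s)"
proof (induction k arbitrary: s)
  case 0
  show ?case by (auto intro!: continuous_intros)
next
  case (Suc k)
  show ?case
  proof (rule Ck_on_SucI)
    show "((\<lambda>x::real. x powr s) has_derivative (\<lambda>v. v *\<^sub>R (s *\<^sub>R (x powr (s - 1))))) (at x)"
      if "x \<in> {0<..}" for x
      using has_real_derivative_powr[of x s] that
      by (simp add: has_field_derivative_def mult_ac mult_commute_abs)
    show "Ck_on k {0<..} (\<lambda>x. v *\<^sub>R (s *\<^sub>R (x powr (s - 1))))" for v
      by (intro Ck_on_scaleR Ck_on_const Suc) simp_all
  qed simp
qed

lemma smooth_on_cong:
  "open U \<Longrightarrow> (\<And>x. x \<in> U \<Longrightarrow> f x = g x) \<Longrightarrow> smooth_on U f \<Longrightarrow> smooth_on U g"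
  unfolding smooth_on_def using Ck_on_cong by blast

lemma smooth_on_imp_continuous_on: "smooth_on U f \<Longrightarrow> continuous_on U f"
  unfolding smooth_on_def using Ck_on_imp_continuous_on by blast

lemma smooth_on_imp_differentiable: "smooth_on U f \<Longrightarrow> x \<in> U \<Longrightarrow> f differentiable (at x)"
  unfolding smooth_on_def by (metis Ck_on.simps(2))

lemma smooth_on_frechet_derivative:
  "smooth_on U f \<Longrightarrow> smooth_on U (\<lambda>x. frechet_derivative f (at x) v)"
  unfolding smooth_on_def by (metis Ck_on.simps(2))

lemma smooth_on_const: "smooth_on U (\<lambda>x. c)"
  by (simp add: smooth_on_def Ck_on_const)

lemma smooth_on_bounded_linear_comp:
  "open U \<Longrightarrow> bounded_linear L \<Longrightarrow> smooth_on U f \<Longrightarrow> smooth_on U (\<lambda>x. L (f x))"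
  by (simp add: smooth_on_def Ck_on_bounded_linear_comp)

lemma smooth_on_add:
  "open U \<Longrightarrow> smooth_on U f \<Longrightarrow> smooth_on U g \<Longrightarrow> smooth_on U (\<lambda>x. f x + g x)"
  by (simp add: smooth_on_def Ck_on_add)

lemma smooth_on_sum:
  "open U \<Longrightarrow> (\<And>i. i \<in> I \<Longrightarrow> smooth_on U (f i)) \<Longrightarrow> smooth_on U (\<lambda>x. \<Sum>i\<in>I. f i x)"
  by (simp add: smooth_on_def Ck_on_sum)

lemma smooth_on_scaleR:
  fixes f :: "'a::real_normed_vector \<Rightarrow> real"
  shows "open U \<Longrightarrow> smooth_on U f \<Longrightarrow> smooth_on U g \<Longrightarrow> smooth_on U (\<lambda>x. f x *\<^sub>R g x)"
  by (simp add: smooth_on_def Ck_on_scaleR)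

lemma smooth_on_mult:
  fixes f g :: "'a::real_normed_vector \<Rightarrow> real"
  shows "open U \<Longrightarrow> smooth_on U f \<Longrightarrow> smooth_on U g \<Longrightarrow> smooth_on U (\<lambda>x. f x * g x)"
  using smooth_on_scaleR[of U f g] by simp

lemma smooth_on_minus:
  "open U \<Longrightarrow> smooth_on U f \<Longrightarrow> smooth_on U (\<lambda>x. - f x)"
  using smooth_on_bounded_linear_comp[OF _ bounded_linear_minus[OF bounded_linear_ident], of U f]
  by simp

lemma smooth_on_diff:
  "open U \<Longrightarrow> smooth_on U f \<Longrightarrow> smooth_on U g \<Longrightarrow> smooth_on U (\<lambda>x. f x - g x)"
  using smooth_on_add[OF _ _ smooth_on_minus, of U f g] by simp

lemma smooth_on_compose:
  fixes f :: "'a::real_normed_vector \<Rightarrow> 'b::euclidean_space"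
  shows "open U \<Longrightarrow> f ` U \<subseteq> V \<Longrightarrow> smooth_on U f \<Longrightarrow> smooth_on V g \<Longrightarrow> smooth_on U (\<lambda>x. g (f x))"
  by (simp add: smooth_on_def Ck_on_compose)

lemma smooth_on_affine:
  assumes "open U" "bounded_linear L"
  shows "smooth_on U (\<lambda>x. L x + c)"
proof -
  have "Ck_on k U L" for k
  proof (cases k)
    case 0
    then show ?thesis using assms linear_continuous_on by auto
  next
    case (Suc j)
    then show ?thesis
      using Ck_on_SucI[OF assms(1) bounded_linear_imp_has_derivative[OF assms(2)]] Ck_on_const by metis
  qed
  then show ?thesis
    by (auto simp: smooth_on_def intro: Ck_on_add[OF assms(1)] Ck_on_const)
qed

lemma smooth_on_powr:
  fixes f :: "'a::real_normed_vector \<Rightarrow> real"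
  assumes "open U" "smooth_on U f" "\<And>x. x \<in> U \<Longrightarrow> f x > 0"
  shows "smooth_on U (\<lambda>x. f x powr s)"
  using smooth_on_compose[OF assms(1) _ assms(2), of "{0<..}" "\<lambda>x. x powr s"] assms(3)
  by (auto simp: smooth_on_def Ck_on_powr)

lemma smooth_on_inverse:
  fixes f :: "'a::real_normed_vector \<Rightarrow> real"
  assumes "open U" "smooth_on U f" "\<And>x. x \<in> U \<Longrightarrow> f x \<noteq> 0"
  shows "smooth_on U (\<lambda>x. inverse (f x))"
proof (rule smooth_on_cong[OF assms(1)])
  (* Writing 1 / y as y (y^2)^(-1) leaves a power with a positive base. *)
  show "smooth_on U (\<lambda>x. f x * (f x * f x) powr - 1)"
    using assms by (intro smooth_on_mult smooth_on_powr)
        (auto simp: zero_less_mult_iff linorder_neq_iff)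
  show "f x * (f x * f x) powr - 1 = inverse (f x)" if "x \<in> U" for x
    using assms(3)[OF that] by (simp add: powr_minus field_simps zero_less_mult_iff)
qed

lemma smooth_on_vec_nth: "open U \<Longrightarrow> smooth_on U f \<Longrightarrow> smooth_on U (\<lambda>x. f x $ i)"
  by (rule smooth_on_bounded_linear_comp[OF _ bounded_linear_vec_nth])

lemma smooth_on_vec:
  fixes f :: "'a::real_normed_vector \<Rightarrow> 'b::real_normed_vector ^ 'n"
  assumes "open U" "\<And>i. smooth_on U (\<lambda>x. f x $ i)"
  shows "smooth_on U f"
proof (rule smooth_on_cong[OF assms(1)])
  have "bounded_linear (axis i :: 'b \<Rightarrow> _ ^ 'n)" for i
  proof (rule bounded_linear_intro[where K = 1])
    show "norm (axis i y :: 'b ^ 'n) \<le> norm y * 1" for y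
      using L2_set_le_sum[of UNIV "\<lambda>j. norm (axis i y $ j)"]
      by (simp add: norm_vec_def axis_def if_distrib[of norm] cong: if_cong)
  qed (auto simp: axis_def vec_eq_iff)
  then show "smooth_on U (\<lambda>x. \<Sum>i\<in>UNIV. axis i (f x $ i))"
    using assms by (intro smooth_on_sum smooth_on_bounded_linear_comp[where L = "axis _"])
  show "(\<Sum>i\<in>UNIV. axis i (f x $ i)) = f x" for x
    by (simp add: vec_eq_iff axis_def if_distrib[of "\<lambda>z. z $ _"] sum.delta cong: if_cong)
qed

text \<open>Expanding \<open>u\<close> in a basis reduces variable arguments of a family of linear maps to constant ones.
  Applied once per argument, this evaluates differential forms on smooth vector fields.\<close>

lemma smooth_on_linear_family:
  fixes u :: "'a::real_normed_vector \<Rightarrow> 'b::euclidean_space"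
  assumes U: "open U" and lin: "\<And>x. x \<in> U \<Longrightarrow> linear (B x)"
    and B: "\<And>v. smooth_on U (\<lambda>x. B x v)" and u: "smooth_on U u"
  shows "smooth_on U (\<lambda>x. B x (u x))"
proof (rule smooth_on_cong[OF U])
  show "smooth_on U (\<lambda>x. \<Sum>b\<in>Basis. (u x \<bullet> b) *\<^sub>R B x b)"
    using B u by (intro smooth_on_sum[OF U] smooth_on_scaleR[OF U]
        smooth_on_bounded_linear_comp[OF U bounded_linear_inner_left])
  fix x assume "x \<in> U"
  then have "(\<Sum>b\<in>Basis. (u x \<bullet> b) *\<^sub>R B x b) = B x (\<Sum>b\<in>Basis. (u x \<bullet> b) *\<^sub>R b)"
    using lin by (simp add: linear_sum linear_scale)
  then show "(\<Sum>b\<in>Basis. (u x \<bullet> b) *\<^sub>R B x b) = B x (u x)"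
    by (simp add: euclidean_representation)
qed

section \<open>Charts and tangent maps\<close>

definition valid_chart :: "('m::topological_space, 'e::real_normed_vector) chart \<Rightarrow> bool" where
  "valid_chart c \<longleftrightarrow> open (fst c) \<and> open (snd c ` fst c) \<and>
     homeomorphism (fst c) (snd c ` fst c) (snd c) (chart_inv c)"

lemma smooth_atlas_valid_chart: "smooth_atlas A \<Longrightarrow> c \<in> A \<Longrightarrow> valid_chart c"
  by (auto simp: smooth_atlas_def valid_chart_def)

lemma chart_at:
  assumes "smooth_atlas A"
  shows "chart_at A p \<in> A" "p \<in> fst (chart_at A p)"
proof -
  have "\<exists>c. c \<in> A \<and> p \<in> fst c" using assms unfolding smooth_atlas_def by blast
  then show "chart_at A p \<in> A" "p \<in> fst (chart_at A p)"
    unfolding chart_at_def by (metis (mono_tags, lifting) someI_ex)+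
qed

lemma chart_inv_chart: "valid_chart c \<Longrightarrow> p \<in> fst c \<Longrightarrow> chart_inv c (snd c p) = p"
  by (auto simp: valid_chart_def homeomorphism_def)

lemma chart_chart_inv:
  assumes "valid_chart c" "x \<in> snd c ` fst c"
  shows "snd c (chart_inv c x) = x" "chart_inv c x \<in> fst c"
  using assms chart_inv_chart by fastforce+

lemma open_chart_image:
  assumes "valid_chart c" "open W"
  shows "open (snd c ` (fst c \<inter> W))"
proof -
  have "openin (top_of_set (snd c ` fst c)) (snd c ` (fst c \<inter> W))"
    using assms by (intro homeomorphism_imp_open_map) (auto simp: valid_chart_def openin_open_Int)
  then show ?thesis
    using assms(1) openin_open_trans by (auto simp: valid_chart_def)
qed

lemma chart_inv_prod:
  assumes "valid_chart c" "valid_chart d" "p \<in> fst c" "q \<in> fst d"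
  shows "chart_inv (fst c \<times> fst d, map_prod (snd c) (snd d)) (snd c p, snd d q) = (p, q)"
proof -
  have "inj_on (map_prod (snd c) (snd d)) (fst c \<times> fst d)"
    by (auto simp: inj_on_def) (metis assms(1,2) chart_inv_chart)+
  then show ?thesis
    using inv_into_f_f[of "map_prod (snd c) (snd d)" "fst c \<times> fst d" "(p, q)"] assms(3,4)
    by (simp add: chart_inv_def)
qed

abbreviation local_rep :: "('m, 'e) chart \<Rightarrow> ('n, 'f) chart \<Rightarrow> ('m \<Rightarrow> 'n) \<Rightarrow> 'e \<Rightarrow> 'f" where
  "local_rep c d F \<equiv> snd d \<circ> F \<circ> chart_inv c"

abbreviation local_deriv ::
    "('m, 'e::real_normed_vector) chart \<Rightarrow> ('n, 'f::real_normed_vector) chart \<Rightarrow> ('m \<Rightarrow> 'n) \<Rightarrow> 'm \<Rightarrow> 'e \<Rightarrow>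
        'f" where
  "local_deriv c d F p \<equiv> frechet_derivative (local_rep c d F) (at (snd c p))"

text \<open>The pointwise shadow of smoothness that a chain rule for \<^const>\<open>tangent_map\<close> needs. Being pointwise,
  it passes to composites without any gluing of chart domains.\<close>

definition chart_differentiable ::
    "('m::t2_space, 'e::real_normed_vector) chart set \<Rightarrow>
     ('n::t2_space, 'f::real_normed_vector) chart set \<Rightarrow> ('m \<Rightarrow> 'n) \<Rightarrow> 'm \<Rightarrow> bool" where
  "chart_differentiable A B F p \<longleftrightarrow> isCont F p \<and>
     (\<forall>c\<in>A. \<forall>d\<in>B. p \<in> fst c \<longrightarrow> F p \<in> fst d \<longrightarrow> local_rep c d F differentiable (at (snd c p)))"

lemma smooth_map_chart_differentiable:
  assumes "smooth_map A B F"
  shows "chart_differentiable A B F p"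
  unfolding chart_differentiable_def
proof (intro conjI ballI impI)
  show "isCont F p"
    using assms by (simp add: smooth_map_on_def continuous_on_eq_continuous_at)
  fix c d assume "c \<in> A" "d \<in> B" "p \<in> fst c" "F p \<in> fst d"
  then show "local_rep c d F differentiable (at (snd c p))"
    using assms smooth_on_imp_differentiable by (fastforce simp: smooth_map_on_def)
qed

lemma chart_differentiable_id:
  assumes "smooth_atlas A"
  shows "chart_differentiable A A id p"
proof (rule smooth_map_chart_differentiable)
  show "smooth_map A A id"
    using assms by (auto simp: smooth_map_on_def smooth_atlas_def vimage_def Int_def)
qed

lemma linear_local_deriv:
  "chart_differentiable A B F p \<Longrightarrow> c \<in> A \<Longrightarrow> d \<in> B \<Longrightarrow> p \<in> fst c \<Longrightarrow> F p \<in> fst d \<Longrightarrow>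
    linear (local_deriv c d F p)"
  by (auto simp: chart_differentiable_def intro: linear_frechet_derivative)

text \<open>The chain rule in charts. The local representative of \<open>H \<circ> F\<close> agrees with the composite of the
  two local representatives only where \<open>F\<close> stays in the chart \<open>d\<close>; continuity of \<open>F\<close> makes this
  a neighbourhood of the point.\<close>

lemma local_rep_compose:
  assumes atlas: "smooth_atlas A" "smooth_atlas B"
    and F: "chart_differentiable A B F p" and H: "chart_differentiable B C H (F p)"
    and c: "c \<in> A" "p \<in> fst c" and d: "d \<in> B" "F p \<in> fst d" and k: "k \<in> C" "H (F p) \<in> fst k"
  shows "(local_rep c k (H \<circ> F) has_derivative local_deriv d k H (F p) \<circ> local_deriv c d F p)
      (at (snd c p))"
proof -
  have vc: "valid_chart c" and vd: "valid_chart d"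
    using atlas c d smooth_atlas_valid_chart by blast+
  have x: "local_rep c d F (snd c p) = snd d (F p)"
    using chart_inv_chart[OF vc c(2)] by simp
  have "(local_rep c d F has_derivative local_deriv c d F p) (at (snd c p))"
    using F c d by (auto simp: chart_differentiable_def frechet_derivative_works)
  moreover have "(local_rep d k H has_derivative local_deriv d k H (F p))
      (at (local_rep c d F (snd c p)))"
    using H d k x by (auto simp: chart_differentiable_def frechet_derivative_works)
  ultimately have D: "(local_rep d k H \<circ> local_rep c d F has_derivative
      local_deriv d k H (F p) \<circ> local_deriv c d F p) (at (snd c p))"
    by (rule diff_chain_at)
  have "open (fst d)" using vd by (simp add: valid_chart_def)
  then obtain N where N: "open N" "p \<in> N" "\<forall>q\<in>N. F q \<in> fst d"
    using F d(2) unfolding chart_differentiable_def continuous_at_open by metis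
  show ?thesis
  proof (rule has_derivative_transform_within_open[OF D open_chart_image[OF vc N(1)]])
    show "snd c p \<in> snd c ` (fst c \<inter> N)" using c N by blast
    fix x assume "x \<in> snd c ` (fst c \<inter> N)"
    then show "(local_rep d k H \<circ> local_rep c d F) x = local_rep c k (H \<circ> F) x"
      using N(3) by (auto simp: chart_inv_chart[OF vc] chart_inv_chart[OF vd])
  qed
qed

lemma chart_differentiable_compose:
  assumes "smooth_atlas A" "smooth_atlas B"
    and F: "chart_differentiable A B F p" and H: "chart_differentiable B C H (F p)"
  shows "chart_differentiable A C (H \<circ> F) p"
  unfolding chart_differentiable_def
proof (intro conjI ballI impI)
  show "isCont (H \<circ> F) p"
    using F H unfolding o_def by (auto simp: chart_differentiable_def intro: isCont_o2)
  fix c k assume "c \<in> A" "k \<in> C" "p \<in> fst c" "(H \<circ> F) p \<in> fst k"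
  then show "local_rep c k (H \<circ> F) differentiable (at (snd c p))"
    using local_rep_compose[OF assms, of c "chart_at B (F p)" k] chart_at[OF assms(2)]
    by (auto intro: differentiableI)
qed

lemma local_deriv_compose:
  assumes "smooth_atlas A" "smooth_atlas B"
    and "chart_differentiable A B F p" "chart_differentiable B C H (F p)"
    and "c \<in> A" "p \<in> fst c" "d \<in> B" "F p \<in> fst d" "k \<in> C" "H (F p) \<in> fst k"
  shows "local_deriv c k (H \<circ> F) p = local_deriv d k H (F p) \<circ> local_deriv c d F p"
  using local_rep_compose[OF assms] frechet_derivative_at by metis

lemma local_deriv_self:
  assumes "valid_chart c" "p \<in> fst c"
  shows "local_deriv c c id p = id"
proof -
  have "(id has_derivative id) (at (snd c p))" by simp
  then have "(local_rep c c id has_derivative id) (at (snd c p))"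
    by (rule has_derivative_transform_within_open[where s = "snd c ` fst c"])
      (use assms chart_inv_chart[OF assms(1)] in \<open>auto simp: valid_chart_def\<close>)
  then show ?thesis using frechet_derivative_at by metis
qed

lemma tangent_map_def': "tangent_map A B F p = local_deriv (chart_at A p) (chart_at B (F p)) F p"
  by (simp add: tangent_map_def)

lemma coord_vector_def': "coord_vector A c p = local_deriv c (chart_at A p) id p"
  by (simp add: coord_vector_def)

lemma linear_tangent_map:
  "smooth_atlas A \<Longrightarrow> smooth_atlas B \<Longrightarrow> chart_differentiable A B F p \<Longrightarrow> linear (tangent_map A B F p)"
  unfolding tangent_map_def' by (intro linear_local_deriv) (auto intro: chart_at)

lemma linear_coord_vector:
  "smooth_atlas A \<Longrightarrow> c \<in> A \<Longrightarrow> p \<in> fst c \<Longrightarrow> linear (coord_vector A c p)"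
  unfolding coord_vector_def' by (intro linear_local_deriv[OF chart_differentiable_id])
      (auto intro: chart_at)

text \<open>The transition to the chart chosen at \<open>p\<close> has the transition back as a right inverse.\<close>

lemma surj_coord_vector:
  assumes "smooth_atlas A" "c \<in> A" "p \<in> fst c"
  shows "surj (coord_vector A c p)"
proof -
  let ?d = "chart_at A p"
  have "local_deriv ?d ?d (id \<circ> id) p = local_deriv c ?d id (id p) \<circ> local_deriv ?d c id p"
    by (rule local_deriv_compose[OF assms(1) assms(1)])
      (use assms chart_at[OF assms(1)] chart_differentiable_id[OF assms(1)] in auto)
  moreover have "local_deriv ?d ?d id p = id"
    using local_deriv_self chart_at[OF assms(1)] smooth_atlas_valid_chart[OF assms(1)] by blast
  ultimately have "coord_vector A c p \<circ> local_deriv ?d c id p = id"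
    by (simp add: coord_vector_def')
  then show ?thesis by (metis surjI comp_eq_dest_lhs id_apply)
qed

lemma tangent_map_compose:
  assumes "smooth_atlas A" "smooth_atlas B" "smooth_atlas C"
    and "chart_differentiable A B F p" "chart_differentiable B C H (F p)"
  shows "tangent_map A C (H \<circ> F) p v = tangent_map B C H (F p) (tangent_map A B F p v)"
  unfolding tangent_map_def' using assms
  by (subst local_deriv_compose[where B = B and d = "chart_at B (F p)"]) (auto intro: chart_at)

lemma tangent_map_id:
  assumes "smooth_atlas A"
  shows "tangent_map A A id p = id"
  unfolding tangent_map_def' using local_deriv_self[OF
      smooth_atlas_valid_chart[OF assms chart_at(1)[OF assms]] chart_at(2)[OF assms]]
  by simp

text \<open>Since \<open>chart_at B (F p)\<close> may vary discontinuously with \<open>p\<close>, dependence on \<open>p\<close> has to be read off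
  in a chart \<open>d\<close> that stays fixed.\<close>

lemma tangent_map_in_chart:
  assumes "smooth_atlas A" "smooth_atlas B" and "chart_differentiable A B F p"
    and "d \<in> B" "F p \<in> fst d"
  shows "tangent_map A B F p v = coord_vector B d (F p) (local_deriv (chart_at A p) d F p v)"
proof -
  have "local_deriv (chart_at A p) (chart_at B (F p)) (id \<circ> F) p
      = local_deriv d (chart_at B (F p)) id (F p) \<circ> local_deriv (chart_at A p) d F p"
    by (rule local_deriv_compose[OF assms(1,2,3) chart_differentiable_id])
      (use assms chart_at in auto)
  then show ?thesis by (simp add: tangent_map_def' coord_vector_def')
qed

abbreviation prod_chart :: "('m, 'e) chart \<Rightarrow> ('n, 'f) chart \<Rightarrow> ('m \<times> 'n, 'e \<times> 'f) chart" where
  "prod_chart c d \<equiv> (fst c \<times> fst d, map_prod (snd c) (snd d))"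

definition rep_domain ::
    "('m, 'e) chart \<Rightarrow> ('n, 'f) chart \<Rightarrow> ('q, 'h) chart \<Rightarrow> ('m \<Rightarrow> 'n \<Rightarrow> 'q) \<Rightarrow> ('e \<times> 'f) set" where
  "rep_domain c d k F = map_prod (snd c) (snd d) ` (fst c \<times> fst d \<inter> (\<lambda>(p, q). F p q) -` fst k)"

lemma smooth_on_rep_domain:
  assumes "smooth_map (prod_atlas A B) C (\<lambda>(p, q). F p q)" "c \<in> A" "d \<in> B" "k \<in> C"
  shows "smooth_on (rep_domain c d k F) (local_rep (prod_chart c d) k (\<lambda>(p, q). F p q))"
proof -
  have "prod_chart c d \<in> prod_atlas A B" using assms unfolding prod_atlas_def by blast
  then show ?thesis using assms(1,4) unfolding smooth_map_on_def rep_domain_def by fastforce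
qed

lemma rep_domainI:
  "p \<in> fst c \<Longrightarrow> q \<in> fst d \<Longrightarrow> F p q \<in> fst k \<Longrightarrow> (snd c p, snd d q) \<in> rep_domain c d k F"
  by (force simp: rep_domain_def)

text \<open>The derivatives of the slices of \<open>F\<close> are partial derivatives of a single smooth map \<open>R\<close>, which
  shows how they depend on the other variable.\<close>

lemma
  assumes F: "smooth_map (prod_atlas A B) C (\<lambda>(p, q). F p q)"
    and valid: "valid_chart c" "valid_chart d"
    and c: "c \<in> A" "p \<in> fst c" and d: "d \<in> B" "q \<in> fst d" and k: "k \<in> C" "F p q \<in> fst k"
  defines "R \<equiv> local_rep (prod_chart c d) k (\<lambda>(p, q). F p q)"
  shows local_rep_right_slice:
      "(local_rep d k (F p) has_derivative (\<lambda>v. frechet_derivative R (at (snd c p, snd d q))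
          (0, v))) (at (snd d q))"
    and local_rep_left_slice:
      "(local_rep c k (\<lambda>p. F p q) has_derivative
          (\<lambda>v. frechet_derivative R (at (snd c p, snd d q)) (v, 0))) (at (snd c p))"
proof -
  have "R differentiable (at (snd c p, snd d q))"
    using smooth_on_imp_differentiable[OF smooth_on_rep_domain[OF F c(1) d(1) k(1)]
        rep_domainI[of p c q d F k, OF c(2) d(2) k(2)]] by (simp add: R_def)
  then have R: "(R has_derivative frechet_derivative R (at (snd c p, snd d q))) (at (snd c p, snd d q))"
    by (simp add: frechet_derivative_works)
  have R_eq: "R (snd c p', snd d q') = snd k (F p' q')" if "p' \<in> fst c" "q' \<in> fst d" for p' q'
    using chart_inv_prod[OF valid that] by (simp add: R_def)
  have "((\<lambda>y. (snd c p, y)) has_derivative (\<lambda>v. (0, v))) (at (snd d q))"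
    by (intro derivative_intros)
  from diff_chain_at[OF this R]
  show "(local_rep d k (F p) has_derivative (\<lambda>v. frechet_derivative R (at (snd c p, snd d q))
      (0, v))) (at (snd d q))"
    unfolding o_def
    by (rule has_derivative_transform_within_open[where s = "snd d ` fst d"])
      (use valid c d R_eq chart_inv_chart[OF valid(1)] chart_inv_chart[OF valid(2)] in \<open>auto simp:
          valid_chart_def\<close>)
  have "((\<lambda>x. (x, snd d q)) has_derivative (\<lambda>v. (v, 0))) (at (snd c p))"
    by (intro derivative_intros)
  from diff_chain_at[OF this R]
  show "(local_rep c k (\<lambda>p. F p q) has_derivative
      (\<lambda>v. frechet_derivative R (at (snd c p, snd d q)) (v, 0))) (at (snd c p))"
    unfolding o_def
    by (rule has_derivative_transform_within_open[where s = "snd c ` fst c"])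
      (use valid c d R_eq chart_inv_chart[OF valid(1)] chart_inv_chart[OF valid(2)] in \<open>auto simp:
          valid_chart_def\<close>)
qed

lemma
  assumes F: "smooth_map (prod_atlas A B) C (\<lambda>(p, q). F p q)"
    and "smooth_atlas A" "smooth_atlas B"
  shows chart_differentiable_right_slice: "chart_differentiable B C (F p) q"
    and chart_differentiable_left_slice: "chart_differentiable A C (\<lambda>p. F p q) p"
proof -
  have cont: "continuous_on UNIV (\<lambda>(p, q). F p q)"
    using F by (simp add: smooth_map_on_def)
  have "continuous_on UNIV (F p)"
    using continuous_on_compose2[OF cont, of UNIV "\<lambda>q. (p, q)"] by (simp add: continuous_intros)
  moreover have "continuous_on UNIV (\<lambda>p. F p q)"
    using continuous_on_compose2[OF cont, of UNIV "\<lambda>p. (p, q)"] by (simp add: continuous_intros)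
  ultimately have c: "isCont (F p) q" "isCont (\<lambda>p. F p q) p"
    by (simp_all add: continuous_on_eq_continuous_at)
  note v = smooth_atlas_valid_chart[OF assms(2)] smooth_atlas_valid_chart[OF assms(3)]
  show "chart_differentiable B C (F p) q"
    unfolding chart_differentiable_def
    using c(1) local_rep_right_slice[OF F v(1)[OF chart_at(1)[OF assms(2)]] v(2) chart_at[OF assms(2)]]
    by (meson differentiableI)
  show "chart_differentiable A C (\<lambda>p. F p q) p"
    unfolding chart_differentiable_def
    using c(2) local_rep_left_slice[OF F v(1) v(2)[OF chart_at(1)[OF assms(3)]] _ _
        chart_at[OF assms(3)]]
    by (meson differentiableI)
qed

text \<open>Continuity of \<open>F\<close> is local, and on the domain of a chart \<open>F\<close> is its smooth local representative
  after the chart.\<close>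

lemma smooth_map_model_iff:
  assumes "smooth_atlas A"
  shows "smooth_map A model_atlas F \<longleftrightarrow> (\<forall>c\<in>A. smooth_on (snd c ` fst c) (\<lambda>x. F (chart_inv c x)))"
proof
  assume "smooth_map A model_atlas F"
  then show "\<forall>c\<in>A. smooth_on (snd c ` fst c) (\<lambda>x. F (chart_inv c x))"
    by (auto simp: smooth_map_on_def model_atlas_def o_def)
next
  assume *: "\<forall>c\<in>A. smooth_on (snd c ` fst c) (\<lambda>x. F (chart_inv c x))"
  have "isCont F p" for p
  proof -
    let ?c = "chart_at A p"
    note c = chart_at[OF assms, of p]
    note valid = smooth_atlas_valid_chart[OF assms c(1)]
    have "continuous_on (fst ?c) (\<lambda>q. F (chart_inv ?c (snd ?c q)))"
      using continuous_on_compose2[OF smooth_on_imp_continuous_on[OF bspec[OF * c(1)]], of "fst ?c"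
          "snd ?c"] valid
      by (auto simp: valid_chart_def homeomorphism_def)
    then have "continuous_on (fst ?c) F"
      by (rule continuous_on_eq) (simp add: chart_inv_chart[OF valid])
    then show ?thesis
      using valid c(2) continuous_on_eq_continuous_at by (auto simp: valid_chart_def)
  qed
  then show "smooth_map A model_atlas F"
    using * by (auto simp: smooth_map_on_def model_atlas_def o_def continuous_on_eq_continuous_at)
qed

section \<open>Matrices of size three\<close>

lemma index3_add:
  "(1::3) + 1 = 2" "(1::3) + 2 = 3" "(2::3) + 1 = 3" "(2::3) + 2 = 1"
  "(3::3) + 1 = 1" "(3::3) + 2 = 2" "(4::3) = 1" "(5::3) = 2"
  by simp_all

lemma index3_distinct:
  "(1::3) \<noteq> 2" "(1::3) \<noteq> 3" "(2::3) \<noteq> 3" "(2::3) \<noteq> 1" "(3::3) \<noteq> 1" "(3::3) \<noteq> 2"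
  by simp_all

text \<open>The adjugate. The indices of type \<open>3\<close> are added modulo \<open>3\<close>, and for cyclic index shifts the
  cofactors carry no sign.\<close>

definition adj3 :: "'a::comm_ring_1^3^3 \<Rightarrow> 'a^3^3" where
  "adj3 N = (\<chi> i j. N $ (j + 1) $ (i + 1) * N $ (j + 2) $ (i + 2) - N $ (j + 1) $ (i + 2) * N $
      (j + 2) $ (i + 1))"

lemma mat3_eqI:
  fixes A B :: "'a^3^3"
  assumes "A $ 1 $ 1 = B $ 1 $ 1" "A $ 1 $ 2 = B $ 1 $ 2" "A $ 1 $ 3 = B $ 1 $ 3"
    "A $ 2 $ 1 = B $ 2 $ 1" "A $ 2 $ 2 = B $ 2 $ 2" "A $ 2 $ 3 = B $ 2 $ 3"
    "A $ 3 $ 1 = B $ 3 $ 1" "A $ 3 $ 2 = B $ 3 $ 2" "A $ 3 $ 3 = B $ 3 $ 3"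
  shows "A = B"
  using assms by (simp add: vec_eq_iff forall_3)

lemma adj3_entries:
  "adj3 N $ 1 $ 1 = N $ 2 $ 2 * N $ 3 $ 3 - N $ 2 $ 3 * N $ 3 $ 2"
  "adj3 N $ 1 $ 2 = N $ 3 $ 2 * N $ 1 $ 3 - N $ 3 $ 3 * N $ 1 $ 2"
  "adj3 N $ 1 $ 3 = N $ 1 $ 2 * N $ 2 $ 3 - N $ 1 $ 3 * N $ 2 $ 2"
  "adj3 N $ 2 $ 1 = N $ 2 $ 3 * N $ 3 $ 1 - N $ 2 $ 1 * N $ 3 $ 3"
  "adj3 N $ 2 $ 2 = N $ 3 $ 3 * N $ 1 $ 1 - N $ 3 $ 1 * N $ 1 $ 3"
  "adj3 N $ 2 $ 3 = N $ 1 $ 3 * N $ 2 $ 1 - N $ 1 $ 1 * N $ 2 $ 3"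
  "adj3 N $ 3 $ 1 = N $ 2 $ 1 * N $ 3 $ 2 - N $ 2 $ 2 * N $ 3 $ 1"
  "adj3 N $ 3 $ 2 = N $ 3 $ 1 * N $ 1 $ 2 - N $ 3 $ 2 * N $ 1 $ 1"
  "adj3 N $ 3 $ 3 = N $ 1 $ 1 * N $ 2 $ 2 - N $ 1 $ 2 * N $ 2 $ 1"
  by (simp_all add: adj3_def index3_add)

lemma adj3_mult:
  "N ** adj3 N = mat (det N)" "adj3 N ** N = mat (det N)"
  by (rule mat3_eqI; simp add: matrix_matrix_mult_def sum_3 adj3_entries det_3 mat_def
      index3_distinct algebra_simps)+

lemma adj3_adj3: "adj3 (adj3 N) = (\<chi> i j. det N * N $ i $ j)"
  by (rule mat3_eqI; simp add: adj3_entries det_3 algebra_simps)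

lemma det_adj3: "det (adj3 N) = det N * det N"
  by (simp add: adj3_entries det_3 algebra_simps)

lemma adj3_transpose: "adj3 (transpose N) = transpose (adj3 N)"
  by (rule mat3_eqI; simp add: adj3_entries transpose_def algebra_simps)

lemma adj3_matrix_mult: "adj3 (A ** B) = adj3 B ** adj3 A"
  by (rule mat3_eqI; simp add: adj3_entries matrix_matrix_mult_def sum_3 algebra_simps)

lemma adj3_scaleR: "adj3 (c *\<^sub>R N) = (c * c) *\<^sub>R adj3 (N :: real^3^3)"
  by (rule mat3_eqI; simp add: adj3_entries algebra_simps)

lemma matrix_inv_eqI:
  fixes A B :: "'a::field^'n^'n"
  assumes "A ** B = mat 1"
  shows "matrix_inv A = B"
proof -
  have "B ** A = mat 1" using assms matrix_left_right_inverse by blast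
  then have "A ** matrix_inv A = mat 1 \<and> matrix_inv A ** A = mat 1"
    using assms unfolding matrix_inv_def by (metis (mono_tags, lifting) someI)
  then show ?thesis
    by (metis assms \<open>B ** A = mat 1\<close> matrix_mul_assoc matrix_mul_lid matrix_mul_rid)
qed

lemma mat_scaleR: "c *\<^sub>R mat d = (mat (c * d) :: real^'n^'n)"
  by (simp add: mat_def vec_eq_iff)

lemma matrix_scaleR_right: "A ** (c *\<^sub>R B) = c *\<^sub>R (A ** B :: real^'n^'n)"
  by (simp add: matrix_matrix_mult_def vec_eq_iff sum_distrib_left mult_ac)

lemma inner_transpose: "(A *v x) \<bullet> y = x \<bullet> (transpose A *v y)" for A :: "real^'n^'n"
  by (metis dot_lmul_matrix inner_commute transpose_matrix_vector)

text \<open>The factor \<open>det S\<close> cancels the denominators of the inverse: \<open>tilde S\<close> is polynomial, hence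
  smooth, in \<open>S\<close>.\<close>

lemma tilde_eq_adj3:
  fixes S :: "real^3^3"
  assumes "det S \<noteq> 0"
  shows "tilde S = adj3 S"
proof -
  have "S ** ((1 / det S) *\<^sub>R adj3 S) = mat 1"
    by (simp add: matrix_scaleR_right adj3_mult mat_scaleR assms)
  then show ?thesis
    using assms by (simp add: tilde_def matrix_inv_eqI)
qed

section \<open>The correspondence at a point\<close>

text \<open>The forms of a triple at a point, with \<open>a\<close> and \<open>e\<close> as \<open>\<real>\<^sup>3\<close>-valued covectors. In this shape \<open>a\<close>
  and \<open>e\<close> are paired by one matrix in \<open>\<omega>\<close>, and the terms of \<open>\<psi>\<close> are triple products, so that a
  linear change of \<open>a\<close> and \<open>e\<close> acts by transposes and determinants.\<close>

definition pt_omega :: "('v \<Rightarrow> real^3) \<Rightarrow> ('v \<Rightarrow> real^3) \<Rightarrow> real^3^3 \<Rightarrow> 'v \<Rightarrow> 'v \<Rightarrow> real" where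
  "pt_omega a e S u v =
     a u \<bullet> ((det S powr (- 1 / 2) *\<^sub>R tilde S) *v e v) - a v \<bullet>
         ((det S powr (- 1 / 2) *\<^sub>R tilde S) *v e u)"

definition pt_psi :: "('v \<Rightarrow> real^3) \<Rightarrow> ('v \<Rightarrow> real^3) \<Rightarrow> real^3^3 \<Rightarrow> 'v \<Rightarrow> 'v \<Rightarrow> 'v \<Rightarrow> real" where
  "pt_psi a e S u v w =
     - det S * (e u \<bullet> cross3 (e v) (e w)) + e u \<bullet> cross3 (a v) (a w) - e v \<bullet> cross3 (a u) (a w)
       + e w \<bullet> cross3 (a u) (a v)"

lemma triple_omega_eq_pt:
  "triple_omega X e a S p =
     pt_omega (\<lambda>u. \<chi> k. component X a k p u) (\<lambda>u. \<chi> k. component X e k p u) (S p)"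
  by (intro ext) (simp add: triple_omega_def pt_omega_def wedge11_def inner_vec_def
      matrix_vector_mult_def sum_3 algebra_simps)

lemma hat_eq_cross3: "hat a k u v = cross3 (\<chi> i. a i u) (\<chi> i. a i v) $ k"
  using exhaust_3[of k] by (auto simp: hat_def levi_civita_def sum_3 wedge11_def cross_components
      index3_distinct)

lemma triple_psi_eq_pt:
  "triple_psi X e a S p =
     pt_psi (\<lambda>u. \<chi> k. component X a k p u) (\<lambda>u. \<chi> k. component X e k p u) (S p)"
  by (intro ext) (simp add: triple_psi_def pt_psi_def wedge111_def wedge11_def wedge12_def
      inner_vec_def sum_3 hat_eq_cross3 cross_components algebra_simps)

text \<open>Gram-Schmidt for the inner product of \<open>S\<close>: a vector \<open>S\<close>-orthogonal to the set \<open>Y\<close> of those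
  already found exists as long as \<open>S Y\<close> spans a proper subspace. In odd dimension, the sign of
  \<open>M\<close> adjusts the sign of its determinant.\<close>

lemma posdef_orthonormal_basis:
  fixes S :: "real^3^3"
  assumes "posdef S"
  obtains M where "transpose M ** S ** M = mat 1" "det M > 0"
proof -
  have sym: "x \<bullet> (S *v y) = y \<bullet> (S *v x)" for x y
    using assms inner_transpose[of S x y] by (simp add: posdef_def inner_commute)
  have unit: "\<exists>z. z \<bullet> (S *v z) = 1 \<and> (\<forall>y\<in>Y. y \<bullet> (S *v z) = 0)"
    if Y: "finite Y" "card Y < 3" for Y
  proof -
    have "dim ((*v) S ` Y) \<le> card Y"
      using dim_le_card'[of "(*v) S ` Y"] card_image_le[OF Y(1), of "(*v) S"] Y(1) by simp
    then obtain x where x: "x \<noteq> 0" "\<And>y. y \<in> span ((*v) S ` Y) \<Longrightarrow> orthogonal x y"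
      using orthogonal_to_subspace_exists[of "(*v) S ` Y"] Y(2) by auto
    have pos: "x \<bullet> (S *v x) > 0" using x(1) assms by (auto simp: posdef_def)
    have "y \<bullet> (S *v x) = 0" if "y \<in> Y" for y
      using x(2)[OF span_base, of "S *v y"] that sym[of x y] by (auto simp: orthogonal_def)
    then show ?thesis
      using pos by (intro exI[of _ "(1 / sqrt (x \<bullet> (S *v x))) *\<^sub>R x"])
        (simp add: matrix_vector_mult_scaleR flip: power2_eq_square)
  qed
  obtain u where u: "u \<bullet> (S *v u) = 1" using unit[of "{}"] by auto
  obtain v where v: "v \<bullet> (S *v v) = 1" "u \<bullet> (S *v v) = 0" using unit[of "{u}"] by auto
  obtain w where w: "w \<bullet> (S *v w) = 1" "u \<bullet> (S *v w) = 0" "v \<bullet> (S *v w) = 0"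
  proof -
    have "card {u, v} < 3" by (simp add: card_insert_if)
    then show ?thesis using unit[of "{u, v}"] that by auto
  qed
  define M where "M = transpose (vector [u, v, w] :: real^3^3)"
  have entry: "(transpose M ** S ** M) $ i $ j
      = (vector [u, v, w] :: real^3^3) $ i \<bullet> (S *v (vector [u, v, w] :: real^3^3) $ j)" for i j
    by (simp add: M_def matrix_matrix_mult_def matrix_vector_mult_def inner_vec_def sum_3
        transpose_def algebra_simps)
  have M: "transpose M ** S ** M = mat 1"
    by (rule mat3_eqI; simp add: entry u v w mat_def index3_distinct sym[of v u] sym[of w u]
        sym[of w v])
  then have "det M * det S * det M = 1"
    by (metis det_I det_mul det_transpose)
  then have "det M \<noteq> 0" by auto
  moreover have "transpose (- M) ** S ** (- M) = mat 1"
    using M by (simp add: matrix_matrix_mult_def transpose_def sum_negf)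
  moreover have "det (- M) = - det M"
    by (simp add: det_3)
  ultimately show ?thesis
    using that[of M] that[of "- M"] M by linarith
qed

lemma posdef_det_pos:
  fixes S :: "real^3^3"
  assumes "posdef S"
  shows "det S > 0"
proof -
  obtain M where "transpose M ** S ** M = mat 1" "det M > 0"
    using posdef_orthonormal_basis[OF assms] .
  then have "det M * det S * det M = 1" by (metis det_I det_mul det_transpose)
  then have "det S * (det M)\<^sup>2 = 1" by (simp add: power2_eq_square mult_ac)
  then show ?thesis by (metis zero_less_mult_pos2 zero_less_one \<open>det M > 0\<close> zero_less_power)
qed

text \<open>What a connection form, a solder form and a metric are at a single point, relative to the
  fundamental vectors \<open>V\<close> there.\<close>

definition coframe_triple ::
    "(3 \<Rightarrow> 'v::real_vector) \<Rightarrow> ('v \<Rightarrow> real^3) \<Rightarrow> ('v \<Rightarrow> real^3) \<Rightarrow> real^3^3 \<Rightarrow> bool" where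
  "coframe_triple V a e S \<longleftrightarrow> linear a \<and> linear e \<and> (\<forall>k. a (V k) = axis k 1) \<and>
     (\<forall>k. e (V k) = 0) \<and> surj e \<and> posdef S"

text \<open>The triple is recovered from its forms, the vectors \<open>V\<close>, and vectors \<open>W\<close> with \<open>e(W\<^sub>k)\<close> the
  \<open>k\<close>-th unit vector. Contracting \<open>\<psi>\<close> with two of the \<open>V\<close> leaves a component of \<open>e\<close>.\<close>

definition rec_solder :: "('v \<Rightarrow> 'v \<Rightarrow> 'v \<Rightarrow> real) \<Rightarrow> (3 \<Rightarrow> 'v) \<Rightarrow> 'v \<Rightarrow> real^3" where
  "rec_solder \<psi> V u = (\<chi> k. \<psi> u (V (k + 1)) (V (k + 2)))"

text \<open>The values \<open>\<omega>(V\<^sub>i, W\<^sub>j)\<close> form the matrix \<open>T\<close> that pairs \<open>a\<close> with \<open>e\<close> in \<open>\<omega>\<close>, and the adjugate of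
  \<open>T = (det S)\<^sup>-\<^sup>1\<^sup>/\<^sup>2 adj S\<close> is \<open>S\<close>.\<close>

definition rec_metric :: "('v \<Rightarrow> 'v \<Rightarrow> real) \<Rightarrow> (3 \<Rightarrow> 'v) \<Rightarrow> (3 \<Rightarrow> 'v) \<Rightarrow> real^3^3" where
  "rec_metric \<omega> V W = adj3 (\<chi> i j. \<omega> (V i) (W j))"

text \<open>Contracting \<open>\<psi>\<close> with \<open>V\<^sub>i\<close> leaves \<open>Q\<^sub>i = e\<^sup>i\<^sup>+\<^sup>1 \<and> a\<^sup>i\<^sup>+\<^sup>2 - e\<^sup>i\<^sup>+\<^sup>2 \<and> a\<^sup>i\<^sup>+\<^sup>1\<close>. For
  \<open>i = k + 1\<close>, \<open>Q\<^sub>i(W\<^sub>k\<^sub>+\<^sub>2, u)\<close> is \<open>a\<^sup>k(u)\<close> up to a combination of \<open>e\<^sup>k(u)\<close> and \<open>e\<^sup>k\<^sup>+\<^sup>2(u)\<close>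
  whose coefficients are the values of \<open>a\<^sup>k\<^sup>+\<^sup>2\<close> and \<open>a\<^sup>k\<close> at \<open>W\<^sub>k\<^sub>+\<^sub>2\<close>. The second is a value
  of some \<open>Q\<close>. The first is of the form \<open>a\<^sup>j(W\<^sub>j)\<close>, and
  \<open>q\<^sub>i = a\<^sup>i\<^sup>+\<^sup>1(W\<^sub>i\<^sub>+\<^sub>1) + a\<^sup>i\<^sup>+\<^sup>2(W\<^sub>i\<^sub>+\<^sub>2)\<close> are three linear equations for these three
  numbers.\<close>

definition rec_connection ::
    "('v \<Rightarrow> 'v \<Rightarrow> 'v \<Rightarrow> real) \<Rightarrow> (3 \<Rightarrow> 'v) \<Rightarrow> (3 \<Rightarrow> 'v) \<Rightarrow> 'v \<Rightarrow> real^3" where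
  "rec_connection \<psi> V W u =
     (let q = (\<lambda>i. \<psi> (V i) (W (i + 1)) (W (i + 2))); e = rec_solder \<psi> V u in
      \<chi> k. \<psi> (V (k + 1)) (W (k + 2)) u
         + e $ (k + 2) * \<psi> (V (k + 2)) (W (k + 2)) (W (k + 1))
         - e $ k * ((q k + q (k + 1) - q (k + 2)) / 2))"

lemma
  assumes "coframe_triple V a e S"
  shows rec_solder: "rec_solder (pt_psi a e S) V = e"
    and rec_metric: "(\<And>k. e (W k) = axis k 1) \<Longrightarrow> rec_metric (pt_omega a e S) V W = S"
    and rec_connection: "(\<And>k. e (W k) = axis k 1) \<Longrightarrow> rec_connection (pt_psi a e S) V W = a"
proof -
  have V: "a (V k) = axis k 1" "e (V k) = 0" for k
    using assms by (auto simp: coframe_triple_def)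
  show e: "rec_solder (pt_psi a e S) V = e"
    by (intro ext) (simp add: vec_eq_iff forall_3 rec_solder_def pt_psi_def V index3_add cross_basis
        inner_axis)
  assume W: "\<And>k. e (W k) = axis k 1"
  have "det S > 0" using assms posdef_det_pos by (auto simp: coframe_triple_def)
  have T: "(\<chi> i j. pt_omega a e S (V i) (W j)) = det S powr (- 1 / 2) *\<^sub>R adj3 S"
    using \<open>det S > 0\<close> by (simp add: pt_omega_def V W tilde_eq_adj3 matrix_vector_mult_basis
        inner_axis' column_def vec_eq_iff)
  have "det S powr (- 1 / 2) * det S powr (- 1 / 2) * det S = 1"
    using \<open>det S > 0\<close> by (simp add: powr_minus field_simps flip: powr_add)
  then show "rec_metric (pt_omega a e S) V W = S"
    unfolding rec_metric_def T by (simp add: adj3_scaleR adj3_adj3 vec_eq_iff flip: mult.assoc)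
  show "rec_connection (pt_psi a e S) V W = a"
    by (intro ext) (simp add: vec_eq_iff forall_3 rec_connection_def Let_def e pt_psi_def V W
        index3_add inner_vec_def sum_3
       cross_components axis_def index3_distinct algebra_simps add_divide_distrib diff_divide_distrib)
qed

lemma coframe_triple_unique:
  assumes "coframe_triple V a e S" "coframe_triple V a' e' S'"
    and "pt_omega a e S = pt_omega a' e' S'" "pt_psi a e S = pt_psi a' e' S'"
  shows "a = a' \<and> e = e' \<and> S = S'"
proof -
  have e: "e = e'" using rec_solder[OF assms(1)] rec_solder[OF assms(2)] assms(4) by simp
  have "\<exists>u. e u = axis k 1" for k
    using assms(1) unfolding coframe_triple_def surj_def by metis
  then obtain W where W: "\<And>k. e (W k) = axis k 1" by metis
  show ?thesis
    using rec_metric[OF assms(1) W] rec_metric[OF assms(2), of W] W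
      rec_connection[OF assms(1) W] rec_connection[OF assms(2), of W] assms(3,4) e by simp
qed

lemma inner_cross_matrix:
  fixes A :: "real^3^3"
  shows "(A *v x) \<bullet> cross3 (A *v y) (A *v z) = det A * (x \<bullet> cross3 y z)"
  by (simp add: matrix_vector_mult_def inner_vec_def sum_3 cross_components det_3 algebra_simps)

text \<open>The mixed terms of \<open>\<psi>\<close> change by the factor \<open>det A\<close>, so a matrix of determinant \<open>-1\<close> would not
  do.\<close>

lemma coframe_change:
  fixes A :: "real^3^3"
  assumes "det A = 1" "posdef S"
  shows "pt_omega (\<lambda>u. A *v a u) (\<lambda>u. A *v e u) (A ** S ** transpose A) = pt_omega a e S"
    and "pt_psi (\<lambda>u. A *v a u) (\<lambda>u. A *v e u) (A ** S ** transpose A) = pt_psi a e S"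
proof -
  have d: "det (A ** S ** transpose A) = det S"
    using assms(1) by (simp add: det_mul)
  have "det S \<noteq> 0" using posdef_det_pos[OF assms(2)] by simp
  have *: "tilde (A ** S ** transpose A) = transpose (adj3 A) ** tilde S ** adj3 A"
    using d \<open>det S \<noteq> 0\<close> by (simp add: tilde_eq_adj3 adj3_matrix_mult adj3_transpose matrix_mul_assoc)
  have "(A *v x) \<bullet> ((c *\<^sub>R tilde (A ** S ** transpose A)) *v (A *v y)) = x \<bullet> ((c *\<^sub>R tilde S) *v y)"
      for x y c
  proof -
    have "(A *v x) \<bullet> (tilde (A ** S ** transpose A) *v (A *v y))
        = x \<bullet> (transpose A *v (transpose (adj3 A) *v (tilde S *v (adj3 A *v (A *v y)))))"
      by (simp add: * inner_transpose flip: matrix_vector_mul_assoc)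
    also have "\<dots> = x \<bullet> (tilde S *v y)"
    proof -
      have "transpose A ** transpose (adj3 A) = mat 1"
        by (simp add: adj3_mult assms(1) transpose_mat flip: matrix_transpose_mul)
      then show ?thesis
        by (metis adj3_mult(2) assms(1) matrix_vector_mul_assoc matrix_vector_mul_lid)
    qed
    finally show ?thesis by (simp add: scaleR_matrix_vector_assoc[symmetric])
  qed
  then show "pt_omega (\<lambda>u. A *v a u) (\<lambda>u. A *v e u) (A ** S ** transpose A) = pt_omega a e S"
    by (intro ext) (simp add: pt_omega_def d)
  show "pt_psi (\<lambda>u. A *v a u) (\<lambda>u. A *v e u) (A ** S ** transpose A) = pt_psi a e S"
    by (intro ext) (simp add: pt_psi_def d inner_cross_matrix assms(1))
qed

definition complex_vec :: "real^'n \<Rightarrow> real^'n \<Rightarrow> complex^'n" where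
  "complex_vec x y = (\<chi> k. Complex (x $ k) (y $ k))"

lemma omega0_complex_vec:
  "omega0 (complex_vec x1 y1) (complex_vec x2 y2) = x1 \<bullet> y2 - x2 \<bullet> y1"
  by (simp add: complex_vec_def omega0_def wedge11_def inner_vec_def sum_3 algebra_simps)

lemma psi0_complex_vec:
  "psi0 (complex_vec x1 y1) (complex_vec x2 y2) (complex_vec x3 y3) =
     - (y1 \<bullet> cross3 y2 y3) + y1 \<bullet> cross3 x2 x3 - y2 \<bullet> cross3 x1 x3 + y3 \<bullet> cross3 x1 x2"
  by (simp add: complex_vec_def psi0_def Omega0_def wedge11_def wedge12_def wedge111_def
      inner_vec_def sum_3 cross_components algebra_simps)

text \<open>For \<open>M\<close> with \<open>S\<close>-orthonormal columns, the inverse of \<open>S\<close> is \<open>M M\<^sup>T\<close>. The frame with real part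
  \<open>M\<^sup>T a\<close> and imaginary part \<open>M\<^sup>T e / det M\<close> is adapted, because \<open>det S = (det M)\<^sup>-\<^sup>2\<close>; on the
  \<open>V\<^sub>k\<close> it is the real matrix \<open>M\<^sup>T\<close>, whose determinant is positive. It is onto, hence bijective
  by dimension.\<close>

lemma coframe_triple_adapted_frame:
  fixes V :: "3 \<Rightarrow> 'v::euclidean_space"
  assumes "coframe_triple V a e S" and dim: "DIM('v) = 6"
    and "\<omega> p = pt_omega a e S" "\<psi> p = pt_psi a e S"
  shows "\<exists>f. adapted_frame \<omega> \<psi> p f \<and> Re (Omega0 (f (V 1)) (f (V 2)) (f (V 3))) > 0"
proof -
  have lin: "linear a" "linear e" and V: "\<And>k. a (V k) = axis k 1" "\<And>k. e (V k) = 0"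
    and "surj e" and pos: "posdef S"
    using assms(1) by (auto simp: coframe_triple_def)
  obtain M where M: "transpose M ** S ** M = mat 1" "det M > 0"
    using posdef_orthonormal_basis[OF pos] .
  define d where "d = det M"
  have "d > 0" using M d_def by simp
  have "d * det S * d = 1"
    using M d_def by (metis det_I det_mul det_transpose)
  then have detS: "det S = 1 / d ^ 2" using \<open>d > 0\<close> by (simp add: field_simps power2_eq_square)
  have "M ** (transpose M ** S) = mat 1"
    using M(1) matrix_left_right_inverse by blast
  then have "(M ** transpose M) ** S = mat 1" by (simp add: matrix_mul_assoc)
  then have "S ** (M ** transpose M) = mat 1" using matrix_left_right_inverse by blast
  then have tS: "det S powr (- 1 / 2) *\<^sub>R tilde S = (1 / d) *\<^sub>R (M ** transpose M)"
    using \<open>d > 0\<close> by (simp add: tilde_def matrix_inv_eqI detS powr_divide powr_minus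
        power2_eq_square powr_mult flip: powr_add)
  define z where "z u = complex_vec (transpose M *v a u) ((1 / d) *\<^sub>R (transpose M *v e u))" for u
  have linz: "linear z"
    by (rule linearI) (simp_all add: z_def complex_vec_def vec_eq_iff complex_eq_iff
        linear_add[OF lin(1)] linear_add[OF lin(2)]
        linear_scale[OF lin(1)] linear_scale[OF lin(2)] algebra_simps matrix_vector_mult_scaleR)
  have invM: "invertible (transpose M)"
    using M(2) by (simp add: invertible_det_nz)
  have surj: "surj z"
    unfolding surj_def
  proof
    fix y :: "complex^3"
    (* Adjust e first; adding multiples of the V k then adjusts a and leaves e unchanged. *)
    obtain N where N: "transpose M ** N = mat 1"
      using invM by (auto simp: invertible_def)
    define x1 where "x1 = N *v (\<chi> k. Re (y $ k))"
    define x2 where "x2 = N *v (d *\<^sub>R (\<chi> k. Im (y $ k)))"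
    have x: "transpose M *v x1 = (\<chi> k. Re (y $ k))" "transpose M *v x2 = d *\<^sub>R (\<chi> k. Im (y $ k))"
      by (simp_all only: x1_def x2_def matrix_vector_mul_assoc N matrix_vector_mul_lid)
    obtain w where w: "e w = x2"
      using \<open>surj e\<close> by (metis surjD)
    define u where "u = w + (\<Sum>k\<in>UNIV. (x1 - a w) $ k *\<^sub>R V k)"
    have "e u = x2"
      by (simp add: u_def w V linear_add[OF lin(2)] linear_sum[OF lin(2)] linear_scale[OF lin(2)])
    moreover have "a u = a w + (\<Sum>k\<in>UNIV. (x1 - a w) $ k *\<^sub>R axis k 1)"
      by (simp add: u_def V linear_add[OF lin(1)] linear_sum[OF lin(1)] linear_scale[OF lin(1)])
    moreover have "(\<Sum>k\<in>UNIV. (x1 - a w) $ k *\<^sub>R axis k 1) = x1 - a w"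
      using basis_expansion[of "x1 - a w"] by (simp add: scalar_mult_eq_scaleR)
    ultimately have "e u = x2" "a u = x1" by simp_all
    then have "z u = y"
      using \<open>d > 0\<close> unfolding z_def by (simp only: x)
          (simp add: complex_vec_def vec_eq_iff complex_eq_iff)
    then show "\<exists>u. y = z u" by metis
  qed
  have "bij z"
    using linear_surjective_imp_injective[OF linz surj] surj dim by (simp add: bij_def)
  moreover have "omega0 (z u) (z v) = pt_omega a e S u v" for u v
    unfolding z_def omega0_complex_vec pt_omega_def tS
    by (simp only: inner_transpose transpose_transpose inner_scaleR_right matrix_vector_mul_assoc
        flip: scaleR_matrix_vector_assoc)
  moreover have "psi0 (z u) (z v) (z w) = pt_psi a e S u v w" for u v w
    unfolding z_def psi0_complex_vec pt_psi_def detS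
    using \<open>d > 0\<close> by (simp add: inner_cross_matrix cross_mult_left cross_mult_right d_def[symmetric]
        field_simps power2_eq_square
        del: transpose_matrix_vector)
  moreover have "Re (Omega0 (z (V 1)) (z (V 2)) (z (V 3))) > 0"
  proof -
    have "Re (Omega0 (z (V 1)) (z (V 2)) (z (V 3))) = det M"
      by (simp add: z_def complex_vec_def V Omega0_def wedge111_def wedge12_def wedge11_def
          matrix_vector_mult_basis column_def transpose_def det_3 algebra_simps)
    then show ?thesis using M(2) by simp
  qed
  ultimately show ?thesis
    using linz assms(3,4) unfolding adapted_frame_def by metis
qed

lemma Omega0_eq_det: "Omega0 u v w = det (vector [u, v, w])"
  by (simp add: Omega0_def wedge111_def wedge12_def wedge11_def det_3 algebra_simps)

lemma Omega0_matrix: "Omega0 (F *v u) (F *v v) (F *v w) = det F * Omega0 u v w"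
proof -
  have "vector [F *v u, F *v v, F *v w] = (vector [u, v, w] :: complex^3^3) ** transpose F"
    by (rule mat3_eqI; simp add: matrix_matrix_mult_def matrix_vector_mult_def transpose_def sum_3
        mult_ac)
  then show ?thesis by (simp add: Omega0_eq_det det_mul)
qed

lemma omega0_hermitian: "omega0 u v = Im (\<Sum>k\<in>UNIV. cnj (u $ k) * v $ k)"
  by (simp add: omega0_def wedge11_def sum_3 algebra_simps)

text \<open>Let \<open>F\<close> have the columns \<open>f(V\<^sub>k)\<close>, and put \<open>d = det F\<close>, \<open>H = F\<^sup>* F\<close> and \<open>z = F\<^sup>-\<^sup>1 f\<close>. The
  hermitian form pulled back by \<open>f\<close> is \<open>z\<^sup>* H z\<close> and the complex volume form is \<open>d\<close> times that
  of \<open>z\<close>. Taking imaginary parts with \<open>z = a + \<i> e / d\<close> gives \<open>\<omega>\<close> and \<open>\<psi>\<close>, since \<open>det H = d\<^sup>2\<close>.\<close>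

lemma adapted_frame_coframe_triple:
  fixes V :: "3 \<Rightarrow> 'v::real_vector"
  assumes f: "adapted_frame \<omega> \<psi> p f"
    and or: "Re (Omega0 (f (V 1)) (f (V 2)) (f (V 3))) > 0"
    and lag: "\<And>i j. \<omega> p (V i) (V j) = 0" and spec: "\<psi> p (V 1) (V 2) (V 3) = 0"
  shows "\<exists>a e S. coframe_triple V a e S \<and> \<omega> p = pt_omega a e S \<and> \<psi> p = pt_psi a e S"
proof -
  have linf: "linear f" and "bij f" and om: "\<And>u v. \<omega> p u v = omega0 (f u) (f v)"
    and ps: "\<And>u v w. \<psi> p u v w = psi0 (f u) (f v) (f w)"
    using f by (auto simp: adapted_frame_def)
  define F :: "complex^3^3" where "F = (\<chi> i j. f (V j) $ i)"
  define d where "d = Re (det F)"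
  have "det F = Omega0 (f (V 1)) (f (V 2)) (f (V 3))"
    by (simp add: F_def Omega0_def wedge111_def wedge12_def wedge11_def det_3 algebra_simps)
  moreover have "Im (Omega0 (f (V 1)) (f (V 2)) (f (V 3))) = 0"
    using spec by (simp add: ps psi0_def)
  ultimately have detF: "det F = of_real d" and "d > 0"
    using or by (simp_all add: d_def complex_eq_iff)
  then have "invertible F" by (simp add: invertible_det_nz)
  then obtain N where N: "F ** N = mat 1" "N ** F = mat 1" by (auto simp: invertible_def)
  define H :: "real^3^3" where "H = (\<chi> i j. Re (\<Sum>k\<in>UNIV. cnj (F $ k $ i) * F $ k $ j))"
  have H: "(\<Sum>k\<in>UNIV. cnj (F $ k $ i) * F $ k $ j) = of_real (H $ i $ j)" for i j
    using lag[of i j] by (simp add: H_def om omega0_hermitian F_def complex_eq_iff)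
  have symH: "transpose H = H"
    by (simp add: vec_eq_iff transpose_def H_def mult.commute)
  have detH: "det H = d ^ 2"
  proof -
    have "(of_real (det H) :: complex) = det (\<chi> i j. of_real (H $ i $ j))"
      by (simp add: det_3)
    also have "(\<chi> i j. of_real (H $ i $ j)) = (\<chi> i j. cnj (F $ j $ i)) ** F"
      by (simp add: vec_eq_iff matrix_matrix_mult_def H)
    also have "det \<dots> = cnj (det F) * det F"
    proof -
      have "det (\<chi> i j. cnj (F $ j $ i)) = cnj (det F)" by (simp add: det_3)
      then show ?thesis by (simp add: det_mul)
    qed
    finally show ?thesis using detF
      by (simp add: power2_eq_square flip: of_real_mult)
  qed
  (* Positivity: the quadratic form of H at x is the squared norm of F x. *)
  have posH: "x \<bullet> (H *v x) > 0" if "x \<noteq> 0" for x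
  proof -
    define y where "y = F *v (\<chi> k. of_real (x $ k))"
    have "(of_real (x \<bullet> (H *v x)) :: complex)
        = (\<Sum>i\<in>UNIV. \<Sum>j\<in>UNIV. of_real (x $ i) * (\<Sum>k\<in>UNIV. cnj (F $ k $ i) * F $ k $ j) * of_real
        (x $ j))"
      unfolding H by (simp add: inner_vec_def matrix_vector_mult_def sum_distrib_left mult_ac)
    also have "\<dots> = (\<Sum>k\<in>UNIV. cnj (y $ k) * y $ k)"
      by (simp add: y_def matrix_vector_mult_def sum_3 algebra_simps)
    also have "\<dots> = of_real (\<Sum>k\<in>UNIV. (norm (y $ k))\<^sup>2)"
      by (simp only: of_real_sum complex_norm_square mult.commute)
    finally have eq: "x \<bullet> (H *v x) = (\<Sum>k\<in>UNIV. (norm (y $ k))\<^sup>2)" using of_real_eq_iff by blast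
    have "N *v y = (\<chi> k. of_real (x $ k))"
      by (simp add: y_def matrix_vector_mul_assoc N)
    moreover have "(\<chi> k. of_real (x $ k)) \<noteq> (0 :: complex^3)"
      using that by (simp add: vec_eq_iff)
    ultimately have "y \<noteq> 0" by auto
    then obtain k where "y $ k \<noteq> 0" by (auto simp: vec_eq_iff)
    then have "(\<Sum>k\<in>UNIV. (norm (y $ k))\<^sup>2) > 0"
      by (intro sum_pos2[of UNIV k]) auto
    then show ?thesis using eq by simp
  qed
  (* The inverse of H, since det H = d^2. *)
  define S where "S = (1 / d ^ 2) *\<^sub>R adj3 H"
  have HS: "H ** S = mat 1"
    using \<open>d > 0\<close> by (simp add: S_def matrix_scaleR_right adj3_mult mat_scaleR detH)
  then have SH: "S ** H = mat 1" using matrix_left_right_inverse by blast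
  have "posdef S"
    unfolding posdef_def
  proof (intro conjI allI impI)
    show "transpose S = S"
      using adj3_transpose[of H] by (simp add: S_def symH transpose_scalar)
    fix x :: "real^3" assume "x \<noteq> 0"
    have x: "H *v (S *v x) = x" by (simp add: matrix_vector_mul_assoc HS)
    then have "S *v x \<noteq> 0" using \<open>x \<noteq> 0\<close> by auto
    then show "x \<bullet> (S *v x) > 0" using posH[of "S *v x"] x by (simp add: inner_commute)
  qed
  have "det S * det H = 1" using SH by (metis det_I det_mul)
  then have detS: "det S = 1 / d ^ 2" using \<open>d > 0\<close> by (simp add: detH field_simps)
  have tS: "det S powr (- 1 / 2) *\<^sub>R tilde S = (1 / d) *\<^sub>R H"
    using \<open>d > 0\<close> by (simp add: tilde_def matrix_inv_eqI[OF SH] detS powr_divide powr_minus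
        power2_eq_square powr_mult flip: powr_add)
  define z where "z u = N *v f u" for u
  define a where "a u = (\<chi> k. Re (z u $ k))" for u
  define e where "e u = d *\<^sub>R (\<chi> k. Im (z u $ k))" for u
  have z: "z u = complex_vec (a u) ((1 / d) *\<^sub>R e u)" for u
    using \<open>d > 0\<close> by (simp add: complex_vec_def a_def e_def vec_eq_iff)
  have fz: "f u = F *v z u" for u
    by (simp add: z_def matrix_vector_mul_assoc N)
  have linz: "linear z"
    by (rule linearI) (simp_all add: z_def linear_add[OF linf] linear_scale[OF linf] distrib_left
        sum.distrib
        matrix_vector_mult_def vec_eq_iff scaleR_sum_right)
  have "linear a" "linear e"
    by (rule linearI; simp add: a_def e_def vec_eq_iff linear_add[OF linz] linear_scale[OF linz]
        algebra_simps)+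
  moreover have "z (V k) = axis k 1" for k
  proof -
    have "f (V k) = column k F" by (simp add: F_def column_def vec_eq_iff)
    then have "z (V k) = column k (N ** F)"
      by (simp add: z_def column_def matrix_vector_mult_def matrix_matrix_mult_def)
    then show ?thesis by (simp add: N column_def mat_def axis_def vec_eq_iff eq_commute)
  qed
  then have "a (V k) = axis k 1" "e (V k) = 0" for k
    by (simp_all add: a_def e_def axis_def vec_eq_iff)
  moreover have "surj e"
    unfolding surj_def
  proof
    fix y :: "real^3"
    obtain u where "f u = F *v (\<chi> k. \<i> * of_real (y $ k / d))"
      using \<open>bij f\<close> by (metis bij_pointE)
    then have "z u = (\<chi> k. \<i> * of_real (y $ k / d))"
      by (simp add: z_def matrix_vector_mul_assoc N)
    then show "\<exists>u. y = e u"
      using \<open>d > 0\<close> by (intro exI[of _ u]) (simp add: e_def vec_eq_iff)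
  qed
  ultimately have "coframe_triple V a e S"
    using \<open>posdef S\<close> by (simp add: coframe_triple_def)
  moreover have "\<omega> p u v = pt_omega a e S u v" for u v
  proof -
    have "(\<Sum>k\<in>UNIV. cnj (f u $ k) * f v $ k) =
        (\<Sum>i\<in>UNIV. \<Sum>j\<in>UNIV. cnj (z u $ i) * (\<Sum>k\<in>UNIV. cnj (F $ k $ i) * F $ k $ j) * z v $ j)"
      by (simp add: fz matrix_vector_mult_def sum_3 algebra_simps)
    then have "\<omega> p u v = (\<Sum>i\<in>UNIV. \<Sum>j\<in>UNIV. H $ i $ j *
        (Re (z u $ i) * Im (z v $ j) - Im (z u $ i) * Re (z v $ j)))"
      unfolding om omega0_hermitian H by (simp add: sum_3 algebra_simps)
    also have "\<dots> = (1 / d) * (a u \<bullet> (H *v e v) - e u \<bullet> (H *v a v))"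
      using \<open>d > 0\<close> by (simp add: a_def e_def inner_vec_def matrix_vector_mult_def sum_3 field_simps)
    also have "e u \<bullet> (H *v a v) = a v \<bullet> (H *v e u)"
      using inner_transpose[of H "a v" "e u"] by (simp add: symH inner_commute)
    finally show ?thesis
      unfolding pt_omega_def tS scaleR_matrix_vector_assoc[symmetric] by (simp add: algebra_simps)
  qed
  moreover have "\<psi> p u v w = pt_psi a e S u v w" for u v w
  proof -
    have "\<psi> p u v w = d * psi0 (z u) (z v) (z w)"
      by (simp add: ps psi0_def fz Omega0_matrix detF)
    also have "\<dots> = pt_psi a e S u v w"
      using \<open>d > 0\<close> unfolding z psi0_complex_vec pt_psi_def detS
      by (simp add: cross_mult_left cross_mult_right field_simps power2_eq_square)
    finally show ?thesis .
  qed
  ultimately show ?thesis by blast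
qed

lemma linear_mult_right: "linear L \<Longrightarrow> linear (\<lambda>u. B *v L u)" for L :: "'v::real_vector \<Rightarrow> real^'n"
  using linear_compose[OF _ matrix_vector_mul_linear[of B]] by (simp add: o_def)

lemma posdef_congruence:
  fixes S B :: "real^'n^'n"
  assumes "posdef S" "A ** B = mat 1"
  shows "posdef (B ** S ** transpose B)"
  unfolding posdef_def
proof (intro conjI allI impI)
  show "transpose (B ** S ** transpose B) = B ** S ** transpose B"
    using assms(1) by (simp add: posdef_def matrix_transpose_mul matrix_mul_assoc)
  fix x :: "real^'n" assume "x \<noteq> 0"
  have "transpose B ** transpose A = mat 1"
    using assms(2) by (metis matrix_transpose_mul transpose_mat)
  then have "transpose A ** transpose B = mat 1"
    using matrix_left_right_inverse by blast
  then have "transpose A *v (transpose B *v x) = x"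
    by (simp only: matrix_vector_mul_assoc matrix_vector_mul_lid)
  then have "transpose B *v x \<noteq> 0" using \<open>x \<noteq> 0\<close> by auto
  then have "(transpose B *v x) \<bullet> (S *v (transpose B *v x)) > 0"
    using assms(1) unfolding posdef_def by blast
  then show "x \<bullet> ((B ** S ** transpose B) *v x) > 0"
    by (simp only: inner_transpose transpose_transpose matrix_vector_mul_assoc matrix_mul_assoc)
qed

lemma linear_pt_omega:
  assumes "linear a" "linear e"
  shows "linear (\<lambda>u. pt_omega a e S u v)" "linear (pt_omega a e S u)" "pt_omega a e S u u = 0"
  by (auto intro!: linearI simp: pt_omega_def linear_add[OF assms(1)] linear_add[OF assms(2)]
      linear_scale[OF assms(1)]
      linear_scale[OF assms(2)] inner_add matrix_vector_right_distrib matrix_vector_mult_scaleR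
          algebra_simps)

lemma linear_pt_psi:
  assumes "linear a" "linear e"
  shows "linear (\<lambda>u. pt_psi a e S u v w)" "linear (\<lambda>v. pt_psi a e S u v w)" "linear (pt_psi a e S u v)"
    "pt_psi a e S u u v = 0" "pt_psi a e S u v u = 0" "pt_psi a e S v u u = 0"
proof -
  note lin = linear_add[OF assms(1)] linear_add[OF assms(2)] linear_scale[OF assms(1)]
      linear_scale[OF assms(2)]
    cross_add_left cross_add_right cross_mult_left cross_mult_right
  show "linear (\<lambda>u. pt_psi a e S u v w)" "linear (\<lambda>v. pt_psi a e S u v w)" "linear (pt_psi a e S u v)"
    by (rule linearI; simp add: pt_psi_def lin inner_add algebra_simps)+
  show "pt_psi a e S u u v = 0" "pt_psi a e S u v u = 0" "pt_psi a e S v u u = 0"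
    using cross_skew[of "a v" "a u"] by (simp_all add: pt_psi_def dot_cross_self)
qed

lemma wedge111_eq_cross3:
  "wedge111 (\<lambda>u. L u $ 1) (\<lambda>u. L u $ 2) (\<lambda>u. L u $ 3) u v w = L u \<bullet> cross3 (L v) (L w)"
  by (simp add: wedge111_def wedge12_def wedge11_def inner_vec_def sum_3 cross_components algebra_simps)

text \<open>The nondegeneracy \<open>e\<^sup>1\<^sup>2\<^sup>3 \<noteq> 0\<close> of a solder form, restated. If the triple product does not
  vanish, the matrix with columns \<open>L u\<close>, \<open>L v\<close>, \<open>L w\<close> is invertible.\<close>

lemma surj_iff_triple_product:
  fixes L :: "'v::real_vector \<Rightarrow> real^3"
  assumes "linear L"
  shows "surj L \<longleftrightarrow> (\<exists>u v w. L u \<bullet> cross3 (L v) (L w) \<noteq> 0)"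
proof
  assume "surj L"
  then have "\<exists>u. L u = axis k 1" for k by (metis surjD)
  then obtain W where "\<And>k. L (W k) = axis k 1" by metis
  then show "\<exists>u v w. L u \<bullet> cross3 (L v) (L w) \<noteq> 0"
    by (intro exI[of _ "W 1"] exI[of _ "W 2"] exI[of _ "W 3"]) (simp add: cross_basis inner_axis)
next
  assume "\<exists>u v w. L u \<bullet> cross3 (L v) (L w) \<noteq> 0"
  then obtain u v w where "L u \<bullet> cross3 (L v) (L w) \<noteq> 0" by blast
  then have "invertible (transpose (vector [L u, L v, L w] :: real^3^3))"
    by (simp add: dot_cross_det invertible_det_nz)
  then obtain N :: "real^3^3" where N: "transpose (vector [L u, L v, L w]) ** N = mat 1"
    unfolding invertible_def by blast
  show "surj L"
    unfolding surj_def
  proof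
    fix y
    define x where "x = N *v y"
    have "y = transpose (vector [L u, L v, L w]) *v x"
      by (simp only: x_def matrix_vector_mul_assoc N matrix_vector_mul_lid)
    also have "\<dots> = L (x $ 1 *\<^sub>R u + x $ 2 *\<^sub>R v + x $ 3 *\<^sub>R w)"
      by (simp only: linear_add[OF assms] linear_scale[OF assms])
        (simp add: matrix_vector_mult_def transpose_def vec_eq_iff sum_3 mult.commute del:
            transpose_matrix_vector)
    finally show "\<exists>z. y = L z" by blast
  qed
qed

text \<open>The vectors \<open>L\<^sup>T (L L\<^sup>T)\<^sup>-\<^sup>1 e\<^sub>j\<close>: a section of \<open>L\<close> depending smoothly on \<open>L\<close>.\<close>

definition right_inverse :: "(real^'n \<Rightarrow> real^3) \<Rightarrow> 3 \<Rightarrow> real^'n" where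
  "right_inverse L j = (let M = matrix L; N = M ** transpose M in
     transpose M *v (inverse (det N) *\<^sub>R column j (adj3 N)))"

text \<open>If \<open>L L\<^sup>T x = 0\<close> then \<open>\<bar>L\<^sup>T x\<bar>\<^sup>2 = 0\<close>, so \<open>x\<close> is orthogonal to the range of \<open>L\<close>.\<close>

lemma gram_det_nonzero:
  fixes L :: "real^'n \<Rightarrow> real^3"
  assumes "linear L" "surj L"
  shows "det (matrix L ** transpose (matrix L)) \<noteq> 0"
proof -
  let ?M = "matrix L" and ?N = "matrix L ** transpose (matrix L)"
  have "x = 0" if "?N *v x = 0" for x
  proof -
    have "(x v* ?M) \<bullet> (x v* ?M) = x \<bullet> (?N *v x)"
      by (simp add: dot_lmul_matrix matrix_vector_mul_assoc[symmetric])
    then have "x v* ?M = 0" using that by simp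
    obtain y where "L y = x" using assms(2) by (metis surjD)
    then have "x \<bullet> x = (x v* ?M) \<bullet> y"
      by (metis assms(1) dot_lmul_matrix matrix_vector_mul(2))
    then show ?thesis using \<open>x v* ?M = 0\<close> by simp
  qed
  then have "\<exists>B. B ** ?N = mat 1" using matrix_left_invertible_ker by blast
  then have "invertible ?N" using invertible_left_inverse by blast
  then show ?thesis by (simp add: invertible_det_nz)
qed

lemma column_mat: "column j (mat c :: real^'n^'n) = c *\<^sub>R axis j 1"
  by (auto simp: column_def mat_def axis_def vec_eq_iff)

lemma matrix_mult_column: "A *v column j B = column j (A ** B)"
  by (simp add: column_def matrix_vector_mult_def matrix_matrix_mult_def)

lemma right_inverse:
  fixes L :: "real^'n \<Rightarrow> real^3"
  assumes "linear L" "surj L"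
  shows "L (right_inverse L j) = axis j 1"
proof -
  let ?N = "matrix L ** transpose (matrix L)"
  have L: "L x = matrix L *v x" for x
    by (metis assms(1) matrix_vector_mul(2))
  have "L (right_inverse L j) = ?N *v (inverse (det ?N) *\<^sub>R column j (adj3 ?N))"
    unfolding L[of "right_inverse L j"] by (simp only: right_inverse_def Let_def
        matrix_vector_mul_assoc)
  also have "\<dots> = inverse (det ?N) *\<^sub>R column j (?N ** adj3 ?N)"
    by (simp only: matrix_vector_mult_scaleR matrix_mult_column)
  finally show ?thesis
    using gram_det_nonzero[OF assms] by (simp add: adj3_mult column_mat)
qed

section \<open>Smooth families of triples\<close>

lemma smooth_on_inner3:
  fixes y z :: "'a::real_normed_vector \<Rightarrow> real^3"
  assumes "open U" "smooth_on U y" "smooth_on U z"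
  shows "smooth_on U (\<lambda>x. y x \<bullet> z x)"
  unfolding inner_vec_def sum_3 inner_real_def
  by (intro smooth_on_add[OF assms(1)] smooth_on_mult[OF assms(1)] smooth_on_vec_nth[OF assms(1)] assms)

lemma smooth_on_cross3:
  assumes "open U" "smooth_on U y" "smooth_on U z"
  shows "smooth_on U (\<lambda>x. cross3 (y x) (z x))"
proof (rule smooth_on_vec[OF assms(1)])
  fix i :: 3
  show "smooth_on U (\<lambda>x. cross3 (y x) (z x) $ i)"
    using exhaust_3[of i]
    by (elim disjE; hypsubst; simp only: cross_components;
        intro smooth_on_diff[OF assms(1)] smooth_on_mult[OF assms(1)] smooth_on_vec_nth[OF assms(1)]
            assms)
qed

lemma smooth_on_matrix_entry:
  fixes M :: "'a::real_normed_vector \<Rightarrow> real^'n^'m"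
  shows "open U \<Longrightarrow> smooth_on U M \<Longrightarrow> smooth_on U (\<lambda>x. M x $ i $ j)"
  by (intro smooth_on_vec_nth)

lemma smooth_on_det3:
  fixes M :: "'a::real_normed_vector \<Rightarrow> real^3^3"
  assumes "open U" "smooth_on U M"
  shows "smooth_on U (\<lambda>x. det (M x))"
  unfolding det_3
  by (intro smooth_on_add[OF assms(1)] smooth_on_diff[OF assms(1)] smooth_on_mult[OF assms(1)]
      smooth_on_matrix_entry assms)

lemma smooth_on_adj3:
  fixes M :: "'a::real_normed_vector \<Rightarrow> real^3^3"
  assumes "open U" "smooth_on U M"
  shows "smooth_on U (\<lambda>x. adj3 (M x))"
proof (intro smooth_on_vec[OF assms(1)])
  show "smooth_on U (\<lambda>x. adj3 (M x) $ i $ j)" for i j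
    by (simp add: adj3_def) (intro smooth_on_diff[OF assms(1)] smooth_on_mult[OF assms(1)]
        smooth_on_matrix_entry assms)
qed

lemma smooth_on_matrix_vector:
  fixes M :: "'a::real_normed_vector \<Rightarrow> real^'n^'m"
  assumes "open U" "smooth_on U M" "smooth_on U y"
  shows "smooth_on U (\<lambda>x. M x *v y x)"
proof (intro smooth_on_vec[OF assms(1)])
  show "smooth_on U (\<lambda>x. (M x *v y x) $ i)" for i
    unfolding matrix_vector_mult_def
    by simp (intro smooth_on_sum[OF assms(1)] smooth_on_mult[OF assms(1)] smooth_on_matrix_entry
        smooth_on_vec_nth assms)
qed

lemma smooth_on_matrix_mult:
  fixes M :: "'a::real_normed_vector \<Rightarrow> real^'n^'m" and N :: "'a \<Rightarrow> real^'k^'n"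
  assumes "open U" "smooth_on U M" "smooth_on U N"
  shows "smooth_on U (\<lambda>x. M x ** N x)"
proof (intro smooth_on_vec[OF assms(1)])
  show "smooth_on U (\<lambda>x. (M x ** N x) $ i $ j)" for i j
    unfolding matrix_matrix_mult_def
    by simp (intro smooth_on_sum[OF assms(1)] smooth_on_mult[OF assms(1)] smooth_on_matrix_entry assms)
qed

lemma smooth_on_transpose:
  fixes M :: "'a::real_normed_vector \<Rightarrow> real^'n^'m"
  assumes "open U" "smooth_on U M"
  shows "smooth_on U (\<lambda>x. transpose (M x))"
proof (intro smooth_on_vec[OF assms(1)])
  show "smooth_on U (\<lambda>x. transpose (M x) $ i $ j)" for i j
    by (simp add: transpose_def) (intro smooth_on_matrix_entry assms)
qed

lemma smooth_on_right_inverse: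
  fixes L :: "'a::real_normed_vector \<Rightarrow> real^'n \<Rightarrow> real^3"
  assumes U: "open U" and L: "\<And>v. smooth_on U (\<lambda>x. L x v)"
    and lin: "\<And>x. x \<in> U \<Longrightarrow> linear (L x)" and surj: "\<And>x. x \<in> U \<Longrightarrow> surj (L x)"
  shows "smooth_on U (\<lambda>x. right_inverse (L x) j)"
proof -
  have M: "smooth_on U (\<lambda>x. matrix (L x))"
    by (intro smooth_on_vec[OF U]) (simp add: matrix_def smooth_on_vec_nth[OF U L])
  note N = smooth_on_matrix_mult[OF U M smooth_on_transpose[OF U M]]
  have "smooth_on U (\<lambda>x. column j (adj3 (matrix (L x) ** transpose (matrix (L x)))))"
    by (intro smooth_on_vec[OF U]) (simp add: column_def
        smooth_on_matrix_entry[OF U smooth_on_adj3[OF U N]])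
  then show ?thesis
    unfolding right_inverse_def Let_def
    by (intro smooth_on_matrix_vector[OF U] smooth_on_transpose[OF U M] smooth_on_scaleR[OF U]
        smooth_on_inverse[OF U] smooth_on_det3[OF U] N gram_det_nonzero lin surj)
qed

lemma smooth_on_pt_omega:
  assumes U: "open U" and S: "smooth_on U S" and pos: "\<And>x. x \<in> U \<Longrightarrow> posdef (S x)"
    and ae: "\<And>y. y \<in> {u, v} \<Longrightarrow> smooth_on U (\<lambda>x. a x (y x)) \<and> smooth_on U (\<lambda>x. e x (y x))"
  shows "smooth_on U (\<lambda>x. pt_omega (a x) (e x) (S x) (u x) (v x))"
proof -
  have T: "smooth_on U (\<lambda>x. det (S x) powr (- 1 / 2) *\<^sub>R tilde (S x))"
  proof (rule smooth_on_cong[OF U])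
    show "smooth_on U (\<lambda>x. det (S x) powr (- 1 / 2) *\<^sub>R adj3 (S x))"
      by (intro smooth_on_scaleR[OF U] smooth_on_powr[OF U] smooth_on_det3[OF U]
          smooth_on_adj3[OF U] S posdef_det_pos pos)
    show "det (S x) powr (- 1 / 2) *\<^sub>R adj3 (S x) = det (S x) powr (- 1 / 2) *\<^sub>R tilde (S x)"
        if "x \<in> U" for x
      using posdef_det_pos[OF pos[OF that]] by (simp add: tilde_eq_adj3)
  qed
  show ?thesis
    unfolding pt_omega_def
    by (intro smooth_on_diff[OF U] smooth_on_inner3[OF U] smooth_on_matrix_vector[OF U T])
      (use ae in auto)
qed

lemma smooth_on_pt_psi:
  assumes U: "open U" and S: "smooth_on U S"
    and ae: "\<And>y. y \<in> {u, v, w} \<Longrightarrow> smooth_on U (\<lambda>x. a x (y x)) \<and> smooth_on U (\<lambda>x. e x (y x))"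
  shows "smooth_on U (\<lambda>x. pt_psi (a x) (e x) (S x) (u x) (v x) (w x))"
  unfolding pt_psi_def
  by (intro smooth_on_diff[OF U] smooth_on_add[OF U] smooth_on_inner3[OF U] smooth_on_mult[OF U]
      smooth_on_minus[OF U]
      smooth_on_cross3[OF U] smooth_on_det3[OF U] S) (use ae in auto)

section \<open>The adjoint representation and fundamental fields\<close>

definition coords :: "(3 \<Rightarrow> real^3) \<Rightarrow> real^3 \<Rightarrow> real^3" where
  "coords X y = (\<chi> k. representation (range X) y (X k))"

definition from_coords :: "(3 \<Rightarrow> real^3) \<Rightarrow> real^3 \<Rightarrow> real^3" where
  "from_coords X x = (\<Sum>k\<in>UNIV. x $ k *\<^sub>R X k)"

lemma linear_from_coords: "linear (from_coords X)"
  by (rule linearI) (simp_all add: from_coords_def scaleR_add_left sum.distrib scaleR_sum_right)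

lemma from_coords_axis: "from_coords X (axis k 1) = X k"
  by (simp add: from_coords_def axis_def if_distrib[of "\<lambda>c. c *\<^sub>R _"] cong: if_cong)

lemma
  assumes "is_basis X"
  shows linear_coords: "linear (coords X)"
    and coords_basis: "coords X (X k) = axis k 1"
    and from_coords_coords: "from_coords X (coords X y) = y"
    and coords_from_coords: "coords X (from_coords X x) = x"
proof -
  have X: "inj X" "independent (range X)" "\<And>y. y \<in> span (range X)"
    using assms by (auto simp: is_basis_def)
  show lin: "linear (coords X)"
    by (rule linearI) (simp_all add: coords_def vec_eq_iff
        real_vector.representation_add[OF X(2) X(3) X(3)]
        real_vector.representation_scale[OF X(2) X(3)])
  show b: "coords X (X k) = axis k 1" for k
  proof -
    have "coords X (X k) $ i = axis k 1 $ i" for i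
      using X(1) by (simp add: coords_def real_vector.representation_basis[OF X(2)] axis_def inj_eq)
    then show ?thesis by (simp add: vec_eq_iff)
  qed
  show "from_coords X (coords X y) = y"
  proof -
    have "(\<Sum>b\<in>range X. representation (range X) y b *\<^sub>R b) = y"
      by (rule real_vector.sum_representation_eq[OF X(2) X(3)]) auto
    then show ?thesis
      by (simp add: from_coords_def coords_def sum.reindex[OF X(1)])
  qed
  show "coords X (from_coords X x) = x"
    using basis_expansion[of x]
    by (simp add: from_coords_def linear_sum[OF lin] linear_scale[OF lin] b scalar_mult_eq_scaleR)
qed

lemma component_eq_coords: "(\<chi> k. component X \<alpha> k p u) = coords X (\<alpha> p u)"
  by (simp add: component_def coords_def)

lemma matrix_mult_apply: "linear f \<Longrightarrow> matrix f *v x = f x" for f :: "real^'n \<Rightarrow> real^'m"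
  by (metis matrix_vector_mul(2))

lemma continuous_on_det_deriv:
  fixes R :: "'a::real_normed_vector \<Rightarrow> real^3" and j :: "real^3 \<Rightarrow> 'a"
  assumes "smooth_on O' R" "continuous_on N z" "z ` N \<subseteq> O'"
  shows "continuous_on N (\<lambda>g. det (matrix (\<lambda>v. frechet_derivative R (at (z g)) (j v))))"
proof -
  have "continuous_on N (\<lambda>g. frechet_derivative R (at (z g)) w)" for w
    using continuous_on_compose2[OF smooth_on_imp_continuous_on[OF
        smooth_on_frechet_derivative[OF assms(1)]] assms(2,3)] .
  then show ?thesis
    unfolding det_3 matrix_def by (simp add: continuous_intros)
qed

locale unimodular_principal_bundle =
  fixes G :: "'g::{t2_space, second_countable_topology} monoid" (structure)
    and AG :: "('g, real^3) chart set"
    and AP :: "('p::{t2_space, second_countable_topology}, real^6) chart set"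
    and AM :: "('m::{t2_space, second_countable_topology}, real^3) chart set"
    and \<pi> :: "'p \<Rightarrow> 'm"
    and act :: "'p \<Rightarrow> 'g \<Rightarrow> 'p"
    and X :: "3 \<Rightarrow> real^3"
  assumes lie: "lie_group G AG"
    and conn: "connected (UNIV :: 'g set)"
    and unimod: "unimodular G AG"
    and basis: "is_basis X"
    and principal: "principal_bundle G AG AP AM \<pi> act"
begin

lemma is_group: "group G" and carrier: "carrier G = UNIV"
  and AG: "smooth_atlas AG" and mult_smooth: "smooth_map (prod_atlas AG AG) AG (\<lambda>(g, h). g \<otimes> h)"
  and inv_smooth: "smooth_map AG AG (\<lambda>g. inv g)"
  using lie by (auto simp: lie_group_def)

lemma AP: "smooth_atlas AP" and AM: "smooth_atlas AM" and proj_smooth: "smooth_map AP AM \<pi>"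
  and act_smooth: "smooth_map (prod_atlas AP AG) AP (\<lambda>(p, g). act p g)"
  and act_one: "act p \<one> = p" and act_act: "act (act p g) h = act p (g \<otimes> h)"
  and proj_act: "\<pi> (act p g) = \<pi> p"
  using principal by (auto simp: principal_bundle_def)

lemma valid_chartG: "c \<in> AG \<Longrightarrow> valid_chart c" and valid_chartP: "d \<in> AP \<Longrightarrow> valid_chart d"
  using AG AP smooth_atlas_valid_chart by blast+

sublocale group G by (rule is_group)

lemma in_carrier [simp]: "g \<in> carrier G"
  by (simp add: carrier)

lemma mult_differentiable:
  "chart_differentiable AG AG (\<lambda>h. g \<otimes> h) q" "chart_differentiable AG AG (\<lambda>h. h \<otimes> g) q"
  using chart_differentiable_right_slice[OF mult_smooth AG AG]
      chart_differentiable_left_slice[OF mult_smooth AG AG] by blast+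

lemma conj_eq: "(\<lambda>h. g \<otimes> h \<otimes> inv g) = (\<lambda>h. h \<otimes> inv g) \<circ> (\<lambda>h. g \<otimes> h)"
  by auto

lemma conj_differentiable: "chart_differentiable AG AG (\<lambda>h. g \<otimes> h \<otimes> inv g) q"
  unfolding conj_eq by (rule chart_differentiable_compose[OF AG AG mult_differentiable])

lemma linear_Ad: "linear (Ad G AG g)"
  unfolding Ad_def by (rule linear_tangent_map[OF AG AG conj_differentiable])

lemma Ad_one: "Ad G AG \<one> = id"
proof -
  have "(\<lambda>h. \<one> \<otimes> h \<otimes> inv \<one>) = id" by auto
  then show ?thesis by (simp only: Ad_def tangent_map_id[OF AG])
qed

text \<open>Conjugation by \<open>g\<close> is a left translation followed by a right translation. In charts around \<open>\<one>\<close>,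
  \<open>g0\<close> and the inverse of \<open>g0\<close>, fixed while \<open>g\<close> varies near \<open>g0\<close>, their derivatives are partial
  derivatives of the multiplication, which depend continuously on \<open>g\<close>.\<close>

lemma isCont_det_Ad: "isCont (\<lambda>g. det (matrix (Ad G AG g))) g0"
proof -
  define c where "c = chart_at AG \<one>"
  define d where "d = chart_at AG g0"
  define d' where "d' = chart_at AG (inv g0)"
  have c: "c \<in> AG" "\<one> \<in> fst c" and d: "d \<in> AG" "g0 \<in> fst d" and d': "d' \<in> AG" "inv g0 \<in> fst d'"
    using chart_at[OF AG] by (auto simp: c_def d_def d'_def)
  note valid = valid_chartG[OF c(1)] valid_chartG[OF d(1)] valid_chartG[OF d'(1)]
  define N where "N = fst d \<inter> (\<lambda>g. inv g) -` fst d'"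
  have cont_inv: "continuous_on UNIV (\<lambda>g. inv g)"
    using inv_smooth by (simp add: smooth_map_on_def)
  have "open N"
    using valid cont_inv by (auto simp: N_def valid_chart_def intro!: open_Int open_vimage)
  have "g0 \<in> N" using d d' by (simp add: N_def)
  define R where "R = local_rep (prod_chart d c) d (\<lambda>(g, h). g \<otimes> h)"
  define R' where "R' = local_rep (prod_chart d d') c (\<lambda>(g, h). g \<otimes> h)"
  define D where "D g v = frechet_derivative R (at (snd d g, snd c \<one>)) (0, v)" for g v
  define D' where "D' g v = frechet_derivative R' (at (snd d g, snd d' (inv g))) (v, 0)" for g v
  have D: "local_deriv c d (\<lambda>h. g \<otimes> h) \<one> = D g" and D': "local_deriv d c (\<lambda>h. h \<otimes> inv g) g = D' g"
    and lin: "linear (D g)" "linear (D' g)" if "g \<in> N" for g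
  proof -
    have 1: "(local_rep c d (\<lambda>h. g \<otimes> h) has_derivative D g) (at (snd c \<one>))"
      using local_rep_right_slice[OF mult_smooth valid(2,1) d(1) _ c d(1), of g] that
      by (simp add: D_def[abs_def] R_def N_def)
    have 2: "(local_rep d c (\<lambda>h. h \<otimes> inv g) has_derivative D' g) (at (snd d g))"
      using local_rep_left_slice[OF mult_smooth valid(2,3) d(1) _ d'(1) _ c(1), of g "inv g"] that c
      by (simp add: D'_def[abs_def] R'_def N_def)
    show "local_deriv c d (\<lambda>h. g \<otimes> h) \<one> = D g" "local_deriv d c (\<lambda>h. h \<otimes> inv g) g = D' g"
      using frechet_derivative_at[OF 1] frechet_derivative_at[OF 2] by simp_all
    show "linear (D g)" "linear (D' g)"
      using 1 2 has_derivative_linear by blast+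
  qed
  have eq: "det (matrix (Ad G AG g)) = det (matrix (D' g)) * det (matrix (D g))" if "g \<in> N" for g
  proof -
    have "Ad G AG g = local_deriv c c ((\<lambda>h. h \<otimes> inv g) \<circ> (\<lambda>h. g \<otimes> h)) \<one>"
      unfolding Ad_def tangent_map_def' conj_eq by (simp add: c_def)
    also have "\<dots> = local_deriv d c (\<lambda>h. h \<otimes> inv g) (g \<otimes> \<one>) \<circ> local_deriv c d (\<lambda>h. g \<otimes> h) \<one>"
      using that c d by (intro local_deriv_compose[OF AG AG mult_differentiable]) (auto simp: N_def)
    also have "\<dots> = D' g \<circ> D g" using D[OF that] D'[OF that] by simp
    finally show ?thesis
      using matrix_compose[OF lin[OF that]] by (simp add: det_mul)
  qed
  have contd: "continuous_on N (snd d)" and contd': "continuous_on N (\<lambda>g. snd d' (inv g))"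
    using valid(2,3) continuous_on_compose2[of "fst d'" "snd d'" N "\<lambda>g. inv g"]
    by (auto simp: valid_chart_def homeomorphism_def N_def intro: continuous_on_subset
        continuous_on_subset[OF cont_inv])
  have "continuous_on N (\<lambda>g. det (matrix (D' g)) * det (matrix (D g)))"
    unfolding D_def[abs_def] D'_def[abs_def] R_def R'_def
  proof (intro continuous_on_mult continuous_on_det_deriv)
    show "smooth_on (rep_domain d d' c (\<otimes>)) (local_rep (prod_chart d d') c (\<lambda>(g, h). g \<otimes> h))"
      "smooth_on (rep_domain d c d (\<otimes>)) (local_rep (prod_chart d c) d (\<lambda>(g, h). g \<otimes> h))"
      by (rule smooth_on_rep_domain[OF mult_smooth]; fact)+
    show "continuous_on N (\<lambda>g. (snd d g, snd d' (inv g)))" "continuous_on N (\<lambda>g. (snd d g, snd c \<one>))"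
      using contd contd' by (auto intro: continuous_intros)
    show "(\<lambda>g. (snd d g, snd d' (inv g))) ` N \<subseteq> rep_domain d d' c (\<otimes>)"
      using c by (auto simp: N_def intro!: rep_domainI)
    show "(\<lambda>g. (snd d g, snd c \<one>)) ` N \<subseteq> rep_domain d c d (\<otimes>)"
      using c by (auto simp: N_def intro!: rep_domainI)
  qed
  then have "continuous_on N (\<lambda>g. det (matrix (Ad G AG g)))"
    by (rule continuous_on_eq) (simp add: eq)
  then show ?thesis
    using \<open>open N\<close> \<open>g0 \<in> N\<close> continuous_on_eq_continuous_at by blast
qed

lemma det_Ad: "det (matrix (Ad G AG g)) = 1"
proof -
  let ?f = "\<lambda>g. det (matrix (Ad G AG g))"
  have "continuous_on UNIV ?f"
    using isCont_det_Ad by (simp add: continuous_on_eq_continuous_at)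
  moreover have "finite (range ?f)"
  proof (rule finite_subset)
    show "range ?f \<subseteq> {1, - 1}"
      using unimod unfolding unimodular_def by blast
  qed simp
  ultimately have "?f constant_on UNIV"
    by (rule continuous_finite_range_constant[OF conn])
  then have "?f g = ?f \<one>" by (auto simp: constant_on_def)
  then show ?thesis by (simp add: Ad_one matrix_id_mat_1)
qed

lemma coords_Ad: "coords X (Ad G AG g y) = Ad_matrix G AG X g *v coords X y"
  and det_Ad_matrix: "det (Ad_matrix G AG X g) = 1"
proof -
  let ?A = "coords X \<circ> Ad G AG g \<circ> from_coords X"
  have M: "Ad_matrix G AG X g = matrix ?A"
    by (simp add: Ad_matrix_def matrix_def coords_def from_coords_axis)
  have lin: "linear ?A"
    by (intro linear_compose linear_from_coords linear_Ad linear_coords[OF basis])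
  show "coords X (Ad G AG g y) = Ad_matrix G AG X g *v coords X y"
    by (simp add: M matrix_mult_apply[OF lin] from_coords_coords[OF basis])
  have "coords X \<circ> from_coords X = id"
    using coords_from_coords[OF basis] by auto
  then have "matrix (coords X) ** matrix (from_coords X) = mat 1"
    using matrix_compose[OF linear_from_coords linear_coords[OF basis]] by (metis matrix_id_mat_1)
  then have "det (matrix (coords X)) * det (matrix (from_coords X)) = 1"
    by (metis det_I det_mul)
  then show "det (Ad_matrix G AG X g) = 1"
    unfolding M
    by (simp add: matrix_compose linear_compose linear_from_coords linear_Ad linear_coords[OF basis]
        det_mul det_Ad)
qed

lemma act_differentiable:
  "chart_differentiable AG AP (act p) g" "chart_differentiable AP AP (\<lambda>q. act q g) p"
  using chart_differentiable_right_slice[OF act_smooth AP AG]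
      chart_differentiable_left_slice[OF act_smooth AP AG] by blast+

abbreviation "fund \<xi> p \<equiv> fundamental G AG AP act \<xi> p"

lemma linear_fundamental: "linear (\<lambda>\<xi>. fund \<xi> p)"
  unfolding fundamental_def using linear_tangent_map[OF AG AP act_differentiable(1)] .

lemma fundamental_vertical: "fund \<xi> p \<in> vertical AP AM \<pi> p"
proof -
  have "tangent_map AG AM (\<pi> \<circ> act p) \<one> \<xi> = tangent_map AP AM \<pi> (act p \<one>) (fund \<xi> p)"
    unfolding fundamental_def
    by (rule tangent_map_compose[OF AG AP AM act_differentiable(1)
        smooth_map_chart_differentiable[OF proj_smooth]])
  moreover have "tangent_map AG AM (\<pi> \<circ> act p) \<one> \<xi> = 0"
  proof -
    have "\<pi> \<circ> act p = (\<lambda>g. \<pi> p)" by (auto simp: proj_act)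
    then show ?thesis by (simp only: tangent_map_def) (simp add: o_def)
  qed
  ultimately show ?thesis
    by (simp add: vertical_def act_one)
qed

text \<open>Differentiate \<open>(p h) g = (p g) (g\<^sup>-\<^sup>1 h g)\<close> at \<open>h = \<one>\<close>.\<close>

lemma right_diff_fundamental:
  "right_diff AP act g p (fund \<xi> p) = fund (Ad G AG (inv g) \<xi>) (act p g)"
proof -
  have "right_diff AP act g p (fund \<xi> p) = tangent_map AG AP ((\<lambda>q. act q g) \<circ> act p) \<one> \<xi>"
    unfolding fundamental_def right_diff_def
    by (subst tangent_map_compose[OF AG AP AP act_differentiable]) (simp add: act_one)
  also have "(\<lambda>q. act q g) \<circ> act p = act (act p g) \<circ> (\<lambda>h. inv g \<otimes> h \<otimes> inv (inv g))"
    by (auto simp: act_act m_assoc[symmetric])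
  also have "tangent_map AG AP \<dots> \<one> \<xi> = fund (Ad G AG (inv g) \<xi>) (act p g)"
    unfolding fundamental_def Ad_def
    by (subst tangent_map_compose[OF AG AG AP conj_differentiable act_differentiable(1)]) simp
  finally show ?thesis .
qed

lemma linear_right_diff: "linear (right_diff AP act g p)"
  unfolding right_diff_def by (rule linear_tangent_map[OF AP AP act_differentiable(2)])

lemma surj_right_diff: "surj (right_diff AP act g p)"
proof -
  have "tangent_map AP AP ((\<lambda>q. act q g) \<circ> (\<lambda>q. act q (inv g))) (act p g) v
      = right_diff AP act g (act (act p g) (inv g)) (right_diff AP act (inv g) (act p g) v)" for v
    unfolding right_diff_def by
        (rule tangent_map_compose[OF AP AP AP act_differentiable(2) act_differentiable(2)])
  moreover have "(\<lambda>q. act q g) \<circ> (\<lambda>q. act q (inv g)) = id"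
    by (auto simp: act_act act_one)
  ultimately have "v = right_diff AP act g p (right_diff AP act (inv g) (act p g) v)" for v
    by (simp add: tangent_map_id[OF AP] act_act act_one)
  then show ?thesis by (metis surjI)
qed

text \<open>The coordinates in the chart \<open>c\<close> of a fundamental vector field, as a partial derivative of the
  action. This form shows that they are smooth.\<close>

definition fund_coord :: "('p, real^6) chart \<Rightarrow> real^3 \<Rightarrow> real^6 \<Rightarrow> real^6" where
  "fund_coord c \<xi> x = frechet_derivative (local_rep (prod_chart c (chart_at AG \<one>)) c (\<lambda>(p, g). act p g))
     (at (x, snd (chart_at AG \<one>) \<one>)) (0, \<xi>)"

lemma fundamental_in_chart:
  assumes "c \<in> AP" "p \<in> fst c"
  shows "fund \<xi> p = coord_vector AP c p (fund_coord c \<xi> (snd c p))"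
proof -
  have "fund \<xi> p = coord_vector AP c (act p \<one>) (local_deriv (chart_at AG \<one>) c (act p) \<one> \<xi>)"
    unfolding fundamental_def
    by (rule tangent_map_in_chart[OF AG AP act_differentiable(1) assms(1)]) (simp add: act_one assms(2))
  moreover have "local_deriv (chart_at AG \<one>) c (act p) \<one> \<xi> = fund_coord c \<xi> (snd c p)"
    using frechet_derivative_at[OF local_rep_right_slice[OF act_smooth valid_chartP[OF assms(1)]
      valid_chartG[OF chart_at(1)[OF AG]] assms chart_at[OF AG] assms(1)], of \<one>] assms(2)
    by (simp add: act_one fund_coord_def fun_eq_iff)
  ultimately show ?thesis by (simp add: act_one)
qed

lemma smooth_on_fund_coord:
  assumes "c \<in> AP"
  shows "smooth_on (snd c ` fst c) (fund_coord c \<xi>)"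
proof -
  let ?y = "snd (chart_at AG \<one>) \<one>"
  let ?R = "local_rep (prod_chart c (chart_at AG \<one>)) c (\<lambda>(p, g). act p g)"
  have U: "open (snd c ` fst c)" using valid_chartP[OF assms] by (simp add: valid_chart_def)
  have "bounded_linear (\<lambda>x::real^6. (x, 0::real^3))"
    by (intro bounded_linear_intros) 
  from smooth_on_affine[OF U this, of "(0, ?y)"]
  have "smooth_on (snd c ` fst c) (\<lambda>x. (x, ?y))" by simp
  moreover have "(\<lambda>x. (x, ?y)) ` (snd c ` fst c) \<subseteq> rep_domain c (chart_at AG \<one>) c act"
    using chart_at[OF AG] by (auto simp: act_one intro!: rep_domainI)
  moreover have "smooth_on (rep_domain c (chart_at AG \<one>) c act)
      (\<lambda>z. frechet_derivative ?R (at z) (0, \<xi>))"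
    by (intro smooth_on_frechet_derivative smooth_on_rep_domain[OF act_smooth] assms chart_at[OF AG])
  ultimately show ?thesis
    unfolding fund_coord_def[abs_def] using smooth_on_compose[OF U] by blast
qed

end

section \<open>The correspondence on the bundle\<close>

context unimodular_principal_bundle
begin

definition fund_frame :: "'p \<Rightarrow> 3 \<Rightarrow> real^6" where
  "fund_frame p k = fund (X k) p"

lemma fund_eq_sum: "fund \<xi> p = (\<Sum>k\<in>UNIV. coords X \<xi> $ k *\<^sub>R fund_frame p k)"
proof -
  have "fund (from_coords X (coords X \<xi>)) p = (\<Sum>k\<in>UNIV. coords X \<xi> $ k *\<^sub>R fund_frame p k)"
    by (simp add: from_coords_def fund_frame_def linear_sum[OF linear_fundamental]
        linear_scale[OF linear_fundamental])
  then show ?thesis by (simp add: from_coords_coords[OF basis])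
qed

lemma fund_frame_vertical: "fund_frame p k \<in> vertical AP AM \<pi> p"
  by (simp add: fund_frame_def fundamental_vertical)

lemma chart_domain: "c \<in> AP \<Longrightarrow> open (snd c ` fst c)"
  using valid_chartP by (auto simp: valid_chart_def)

lemma two_form_along:
  assumes "two_form AP \<omega>" "c \<in> AP" "smooth_on (snd c ` fst c) u" "smooth_on (snd c ` fst c) v"
  shows "smooth_on (snd c ` fst c) (\<lambda>x. \<omega> (chart_inv c x) (coord_vector AP c (chart_inv c x) (u x))
      (coord_vector AP c (chart_inv c x) (v x)))"
proof -
  note U = chart_domain[OF assms(2)]
  have lin: "linear (\<lambda>u. \<omega> p u v)" "linear (\<omega> p u)" for p u v
    using assms(1) by (auto simp: two_form_def)
  have coord: "linear (coord_vector AP c (chart_inv c x))" if "x \<in> snd c ` fst c" for x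
    using linear_coord_vector[OF AP assms(2)] chart_chart_inv[OF valid_chartP[OF assms(2)] that]
        by blast
  have "smooth_on (snd c ` fst c) (\<lambda>x. \<omega> (chart_inv c x) (coord_vector AP c (chart_inv c x) u')
      (coord_vector AP c (chart_inv c x) v'))" for u' v'
    using assms(1,2) by (auto simp: two_form_def Let_def)
  then have "smooth_on (snd c ` fst c) (\<lambda>x. \<omega> (chart_inv c x) (coord_vector AP c (chart_inv c x) (u x))
      (coord_vector AP c (chart_inv c x) v'))" for v'
    by (intro smooth_on_linear_family[OF U _ _ assms(3), where B
        = "\<lambda>x u. \<omega> (chart_inv c x) (coord_vector AP c (chart_inv c x) u)
      (coord_vector AP c (chart_inv c x) v')"])
          (auto intro: linear_compose[OF coord lin(1), unfolded o_def])
  then show ?thesis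
    by (intro smooth_on_linear_family[OF U _ _ assms(4), where B
        = "\<lambda>x v. \<omega> (chart_inv c x) (coord_vector AP c (chart_inv c x) (u x))
      (coord_vector AP c (chart_inv c x) v)"])
          (auto intro: linear_compose[OF coord lin(2), unfolded o_def])
qed

lemma three_form_along:
  assumes "three_form AP \<psi>" "c \<in> AP" "smooth_on (snd c ` fst c) u" "smooth_on (snd c ` fst c) v"
      "smooth_on (snd c ` fst c) w"
  shows "smooth_on (snd c ` fst c) (\<lambda>x. \<psi> (chart_inv c x) (coord_vector AP c (chart_inv c x) (u x))
      (coord_vector AP c (chart_inv c x) (v x)) (coord_vector AP c (chart_inv c x) (w x)))"
proof -
  note U = chart_domain[OF assms(2)]
  let ?\<psi> = "\<lambda>x u v w. \<psi> (chart_inv c x) (coord_vector AP c (chart_inv c x) u)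
      (coord_vector AP c (chart_inv c x) v) (coord_vector AP c (chart_inv c x) w)"
  have lin: "linear (\<lambda>u. \<psi> p u v w)" "linear (\<lambda>v. \<psi> p u v w)" "linear (\<psi> p u v)" for p u v w
    using assms(1) by (auto simp: three_form_def)
  have coord: "linear (coord_vector AP c (chart_inv c x))" if "x \<in> snd c ` fst c" for x
    using linear_coord_vector[OF AP assms(2)] chart_chart_inv[OF valid_chartP[OF assms(2)] that]
        by blast
  have "smooth_on (snd c ` fst c) (\<lambda>x. ?\<psi> x u' v' w')" for u' v' w'
    using assms(1,2) by (auto simp: three_form_def Let_def)
  then have "smooth_on (snd c ` fst c) (\<lambda>x. ?\<psi> x (u x) v' w')" for v' w'
    by (intro smooth_on_linear_family[OF U _ _ assms(3), where B = "\<lambda>x u. ?\<psi> x u v' w'"])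
      (auto intro: linear_compose[OF coord lin(1), unfolded o_def])
  then have "smooth_on (snd c ` fst c) (\<lambda>x. ?\<psi> x (u x) (v x) w')" for w'
    by (intro smooth_on_linear_family[OF U _ _ assms(4), where B = "\<lambda>x v. ?\<psi> x (u x) v w'"])
      (auto intro: linear_compose[OF coord lin(2), unfolded o_def])
  then show ?thesis
    by (intro smooth_on_linear_family[OF U _ _ assms(5), where B = "\<lambda>x w. ?\<psi> x (u x) (v x) w"])
      (auto intro: linear_compose[OF coord lin(3), unfolded o_def])
qed

definition is_triple :: "('p \<Rightarrow> real^6 \<Rightarrow> real^3) \<Rightarrow> ('p \<Rightarrow> real^6 \<Rightarrow> real^3) \<Rightarrow> ('p \<Rightarrow> real^3^3) \<Rightarrow> bool" where
  "is_triple e a S \<longleftrightarrow> solder_form G AG AP AM \<pi> act X e \<and> connection_form G AG AP act a \<and>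
     equivariant_metric G AG AP act X S"

lemma is_triple_coframe:
  assumes "is_triple e a S"
  shows "coframe_triple (fund_frame p) (\<lambda>u. coords X (a p u)) (\<lambda>u. coords X (e p u)) (S p)"
proof -
  have e: "one_form AP e" "\<And>p u. u \<in> vertical AP AM \<pi> p \<Longrightarrow> e p u = 0"
    and nz: "\<exists>u v w. wedge111 (component X e 1 p) (component X e 2 p) (component X e 3 p) u v w \<noteq> 0"
    and a: "one_form AP a" "\<And>p \<xi>. a p (fund \<xi> p) = \<xi>" and S: "posdef (S p)"
    using assms by (auto simp: is_triple_def solder_form_def connection_form_def equivariant_metric_def)
  have lin: "linear (\<lambda>u. coords X (a p u))" "linear (\<lambda>u. coords X (e p u))"
  proof -
    have "linear (a p)" "linear (e p)" using a(1) e(1) by (simp_all add: one_form_def)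
    then show "linear (\<lambda>u. coords X (a p u))" "linear (\<lambda>u. coords X (e p u))"
      using linear_compose[OF _ linear_coords[OF basis], unfolded o_def] by blast+
  qed
  have "component X e k p = (\<lambda>u. coords X (e p u) $ k)" for k
    by (simp add: fun_eq_iff coords_def component_def)
  then have "surj (\<lambda>u. coords X (e p u))"
    using nz unfolding surj_iff_triple_product[OF lin(2)] by (simp add: wedge111_eq_cross3)
  then show ?thesis
    using lin S by (simp add: coframe_triple_def fund_frame_def a(2) e(2)[OF fundamental_vertical]
        coords_basis[OF basis]
        linear_0[OF linear_coords[OF basis]])
qed

lemma triple_forms_eq:
  "triple_omega X e a S p = pt_omega (\<lambda>u. coords X (a p u)) (\<lambda>u. coords X (e p u)) (S p)"
  "triple_psi X e a S p = pt_psi (\<lambda>u. coords X (a p u)) (\<lambda>u. coords X (e p u)) (S p)"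
  by (simp_all add: triple_omega_eq_pt triple_psi_eq_pt component_eq_coords)

lemma triple_structure:
  assumes "is_triple e a S"
  defines "\<omega> \<equiv> triple_omega X e a S" and "\<psi> \<equiv> triple_psi X e a S"
  shows "invariant_slag_structure AP AM \<pi> act \<omega> \<psi>" "fibres_oriented_by G AG AP act X \<omega> \<psi>"
proof -
  let ?a = "\<lambda>p u. coords X (a p u)" and ?e = "\<lambda>p u. coords X (e p u)"
  note coframe = is_triple_coframe[OF assms(1)]
  have \<omega>: "\<omega> p = pt_omega (?a p) (?e p) (S p)" and \<psi>: "\<psi> p = pt_psi (?a p) (?e p) (S p)" for p
    by (simp_all add: \<omega>_def \<psi>_def triple_forms_eq)
  have lin: "linear (?a p)" "linear (?e p)" and pos: "posdef (S p)" for p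
    using coframe[of p] by (auto simp: coframe_triple_def)
  have oa: "one_form AP a" and oe: "one_form AP e" and S: "smooth_map AP model_atlas S"
    using assms(1) by (auto simp: is_triple_def solder_form_def connection_form_def
        equivariant_metric_def)
  have smooth: "smooth_on (snd c ` fst c) (\<lambda>x. coords X
      (\<alpha> (chart_inv c x) (coord_vector AP c (chart_inv c x) v)))"
    if "one_form AP \<alpha>" "c \<in> AP" for \<alpha> c v
  proof (rule smooth_on_bounded_linear_comp[OF chart_domain[OF that(2)], where L = "coords X"])
    show "bounded_linear (coords X)"
      using linear_coords[OF basis] by (simp add: linear_conv_bounded_linear)
    show "smooth_on (snd c ` fst c) (\<lambda>x. \<alpha> (chart_inv c x) (coord_vector AP c (chart_inv c x) v))"
      using that unfolding one_form_def Let_def by blast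
  qed
  have S': "smooth_on (snd c ` fst c) (\<lambda>x. S (chart_inv c x))" if "c \<in> AP" for c
    using S that smooth_map_model_iff[OF AP] by blast
  have "two_form AP \<omega>"
    unfolding two_form_def Let_def \<omega>
  proof (intro conjI allI ballI)
    fix c u v assume "c \<in> AP"
    show "smooth_on (snd c ` fst c) (\<lambda>x. pt_omega (?a (chart_inv c x)) (?e (chart_inv c x))
        (S (chart_inv c x))
        (coord_vector AP c (chart_inv c x) u) (coord_vector AP c (chart_inv c x) v))"
      by (intro smooth_on_pt_omega[OF chart_domain S' pos])
          (use \<open>c \<in> AP\<close> smooth[OF oa \<open>c \<in> AP\<close>] smooth[OF oe \<open>c \<in> AP\<close>] in auto)
  qed (rule linear_pt_omega[OF lin])+
  moreover have "three_form AP \<psi>"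
    unfolding three_form_def Let_def \<psi>
  proof (intro conjI allI ballI)
    fix c u v w assume "c \<in> AP"
    show "smooth_on (snd c ` fst c) (\<lambda>x. pt_psi (?a (chart_inv c x)) (?e (chart_inv c x))
        (S (chart_inv c x))
        (coord_vector AP c (chart_inv c x) u) (coord_vector AP c (chart_inv c x) v)
            (coord_vector AP c (chart_inv c x) w))"
      by (intro smooth_on_pt_psi[OF chart_domain S'])
          (use \<open>c \<in> AP\<close> smooth[OF oa \<open>c \<in> AP\<close>] smooth[OF oe \<open>c \<in> AP\<close>] in auto)
  qed (rule linear_pt_psi[OF lin])+
  moreover have frame: "\<exists>f. adapted_frame \<omega> \<psi> p f \<and> Re
      (Omega0 (f (fund_frame p 1)) (f (fund_frame p 2)) (f (fund_frame p 3))) > 0" for p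
    by (rule coframe_triple_adapted_frame[OF coframe]) (simp_all add: \<omega> \<psi>)
  ultimately have "su3_structure AP \<omega> \<psi>"
    unfolding su3_structure_def by blast
  have inv: "\<omega> (act p g) (right_diff AP act g p u) (right_diff AP act g p v) = \<omega> p u v"
    "\<psi> (act p g) (right_diff AP act g p u) (right_diff AP act g p v) (right_diff AP act g p w)
        = \<psi> p u v w" for p g u v w
  proof -
    let ?A = "Ad_matrix G AG X (inv g)"
    have ea: "?e (act p g) (right_diff AP act g p u) = ?A *v ?e p u"
      "?a (act p g) (right_diff AP act g p u) = ?A *v ?a p u" for u
      using assms(1) by (auto simp: is_triple_def solder_form_def connection_form_def
          Ad_equivariant_def coords_Ad)
    have Sg: "S (act p g) = ?A ** S p ** transpose ?A"
      using assms(1) by (auto simp: is_triple_def equivariant_metric_def Let_def)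
    note change = coframe_change[where a = "?a p" and e = "?e p",
        OF det_Ad_matrix[of "inv g"] pos[of p]]
    show "\<omega> (act p g) (right_diff AP act g p u) (right_diff AP act g p v) = \<omega> p u v"
      unfolding \<omega> change(1)[symmetric] Sg by (simp only: pt_omega_def ea)
    show "\<psi> (act p g) (right_diff AP act g p u) (right_diff AP act g p v) (right_diff AP act g p w)
        = \<psi> p u v w"
      unfolding \<psi> change(2)[symmetric] Sg by (simp only: pt_psi_def ea)
  qed
  have ev: "?e p u = 0" if "u \<in> vertical AP AM \<pi> p" for p u
    using assms(1) that by (auto simp: is_triple_def solder_form_def
        linear_0[OF linear_coords[OF basis]])
  show "invariant_slag_structure AP AM \<pi> act \<omega> \<psi>"
    unfolding invariant_slag_structure_def Let_def
  proof (intro conjI allI ballI)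
    fix p u v assume u: "u \<in> vertical AP AM \<pi> p" and v: "v \<in> vertical AP AM \<pi> p"
    show "\<omega> p u v = 0" unfolding \<omega> by (simp add: pt_omega_def ev[OF u] ev[OF v])
    fix w assume w: "w \<in> vertical AP AM \<pi> p"
    show "\<psi> p u v w = 0" unfolding \<psi> by (simp add: pt_psi_def ev[OF u] ev[OF v] ev[OF w])
  qed (fact \<open>su3_structure AP \<omega> \<psi>\<close> inv)+
  show "fibres_oriented_by G AG AP act X \<omega> \<psi>"
    unfolding fibres_oriented_by_def Let_def using frame by (simp add: fund_frame_def)
qed

text \<open>At each point the triple exists by \<open>adapted_frame_coframe_triple\<close>. Equivariance and smoothness
  are consequences of its uniqueness and of the formulas that prove uniqueness.\<close>

lemma structure_is_triple:
  assumes inv: "invariant_slag_structure AP AM \<pi> act \<omega> \<psi>" and or: "fibres_oriented_by G AG AP act X \<omega> \<psi>"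
  shows "\<exists>e a S. is_triple e a S \<and> \<omega> = triple_omega X e a S \<and> \<psi> = triple_psi X e a S"
proof -
  have \<omega>2: "two_form AP \<omega>" and \<psi>3: "three_form AP \<psi>"
    using inv by (auto simp: invariant_slag_structure_def su3_structure_def)
  have "\<exists>a e S. coframe_triple (fund_frame p) a e S \<and> \<omega> p = pt_omega a e S \<and> \<psi> p = pt_psi a e S" for p
  proof -
    obtain f where "adapted_frame \<omega> \<psi> p f" "Re
        (Omega0 (f (fund_frame p 1)) (f (fund_frame p 2)) (f (fund_frame p 3))) > 0"
      using or unfolding fibres_oriented_by_def Let_def fund_frame_def by blast
    moreover have "\<omega> p (fund_frame p i) (fund_frame p j)
        = 0" "\<psi> p (fund_frame p 1) (fund_frame p 2) (fund_frame p 3) = 0" for i j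
      using inv fund_frame_vertical unfolding invariant_slag_structure_def by blast+
    ultimately show ?thesis by (rule adapted_frame_coframe_triple)
  qed
  then obtain a' e' S where coframe: "\<And>p. coframe_triple (fund_frame p) (a' p) (e' p) (S p)"
    and \<omega>: "\<And>p. \<omega> p = pt_omega (a' p) (e' p) (S p)" and \<psi>: "\<And>p. \<psi> p = pt_psi (a' p) (e' p) (S p)"
    by metis
  have lin: "linear (a' p)" "linear (e' p)" and Va: "a' p (fund_frame p k) = axis k 1"
      and Ve: "e' p (fund_frame p k) = 0"
    and surj: "surj (e' p)" and pos: "posdef (S p)" for p k
    using coframe[of p] by (auto simp: coframe_triple_def)
  define a where "a p u = from_coords X (a' p u)" for p u
  define e where "e p u = from_coords X (e' p u)" for p u
  have ca: "coords X (a p u) = a' p u" and ce: "coords X (e p u) = e' p u" for p u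
    by (simp_all add: a_def e_def coords_from_coords[OF basis])

  (* By uniqueness: pulled back along the action of g and rewritten in the basis X, the triple at
     the point act p g is a triple at p, and by invariance it induces the same two forms there. *)
  have equiv: "a' (act p g) (right_diff AP act g p u) = Ad_matrix G AG X (inv g) *v a' p u"
      "e' (act p g) (right_diff AP act g p u) = Ad_matrix G AG X (inv g) *v e' p u"
      "S (act p g) = Ad_matrix G AG X (inv g) ** S p ** transpose (Ad_matrix G AG X (inv g))" for p g u
  proof -
    let ?A = "Ad_matrix G AG X (inv g)" and ?D = "right_diff AP act g p" and ?q = "act p g"
    let ?B = "adj3 ?A"
    let ?aB = "\<lambda>u. ?B *v a' ?q (?D u)" and ?eB = "\<lambda>u. ?B *v e' ?q (?D u)"
      and ?SB = "?B ** S ?q ** transpose ?B"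
    have AB: "?A ** ?B = mat 1" "?B ** ?A = mat 1" "det ?B = 1"
      by (simp_all add: adj3_mult det_adj3 det_Ad_matrix)
    have DV: "?D (fund_frame p k) = fund (Ad G AG (inv g) (X k)) ?q" for k
      by (simp add: fund_frame_def right_diff_fundamental)
    have fa: "a' ?q (fund \<xi> ?q) = coords X \<xi>" and fe: "e' ?q (fund \<xi> ?q) = 0" for \<xi>
      using basis_expansion[of "coords X \<xi>"]
      by (simp_all add: fund_eq_sum linear_sum[OF lin(1)] linear_sum[OF lin(2)] linear_scale[OF lin(1)]
          linear_scale[OF lin(2)] Va Ve scalar_mult_eq_scaleR)
    have "coframe_triple (fund_frame p) ?aB ?eB ?SB"
      unfolding coframe_triple_def
    proof (intro conjI allI)
      show "linear (\<lambda>u. ?B *v a' ?q (?D u))" "linear (\<lambda>u. ?B *v e' ?q (?D u))"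
        using linear_compose[OF linear_right_diff lin(1)] linear_compose[OF linear_right_diff lin(2)]
        by (auto intro!: linear_mult_right simp: o_def)
      show "?B *v a' ?q (?D (fund_frame p k)) = axis k 1" for k
        by (simp only: DV fa coords_Ad coords_basis[OF basis] matrix_vector_mul_assoc AB
            matrix_vector_mul_lid)
      show "?B *v e' ?q (?D (fund_frame p k)) = 0" for k
        by (simp add: DV fe)
      show "surj (\<lambda>u. ?B *v e' ?q (?D u))"
        unfolding surj_def
      proof
        fix y
        obtain w where "e' ?q w = ?A *v y" using surj by (metis surjD)
        moreover obtain u where "?D u = w" using surj_right_diff by (metis surjD)
        ultimately show "\<exists>u. y = ?B *v e' ?q (?D u)"
          by (intro exI[of _ u]) (simp only: matrix_vector_mul_assoc AB matrix_vector_mul_lid)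
      qed
      show "posdef (?B ** S ?q ** transpose ?B)" by (rule posdef_congruence[OF pos AB(1)])
    qed
    moreover have "pt_omega ?aB ?eB ?SB = \<omega> p"
    proof (intro ext)
      fix u v
      have "pt_omega ?aB ?eB ?SB u v = \<omega> ?q (?D u) (?D v)"
        using coframe_change(1)[where a = "\<lambda>u. a' ?q (?D u)" and e = "\<lambda>u. e' ?q (?D u)",
            OF AB(3) pos[of ?q]] by (simp add: \<omega> pt_omega_def)
      also have "\<dots> = \<omega> p u v"
        using inv unfolding invariant_slag_structure_def Let_def by blast
      finally show "pt_omega ?aB ?eB ?SB u v = \<omega> p u v" .
    qed
    moreover have "pt_psi ?aB ?eB ?SB = \<psi> p"
    proof (intro ext)
      fix u v w
      have "pt_psi ?aB ?eB ?SB u v w = \<psi> ?q (?D u) (?D v) (?D w)"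
        using coframe_change(2)[where a = "\<lambda>u. a' ?q (?D u)" and e = "\<lambda>u. e' ?q (?D u)",
            OF AB(3) pos[of ?q]] by (simp add: \<psi> pt_psi_def)
      also have "\<dots> = \<psi> p u v w"
        using inv unfolding invariant_slag_structure_def Let_def by blast
      finally show "pt_psi ?aB ?eB ?SB u v w = \<psi> p u v w" .
    qed
    ultimately have *: "a' p = (\<lambda>u. ?B *v a' ?q (?D u))" "e' p = (\<lambda>u. ?B *v e' ?q (?D u))"
      "S p = ?B ** S ?q ** transpose ?B"
      using coframe_triple_unique[OF coframe] \<omega> \<psi> by metis+
    show "a' ?q (?D u) = ?A *v a' p u" "e' ?q (?D u) = ?A *v e' p u"
      by (simp_all only: * matrix_vector_mul_assoc AB matrix_vector_mul_lid)
    have "transpose ?B ** transpose ?A = mat 1"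
      using AB(1) by (metis matrix_transpose_mul transpose_mat)
    moreover have "?A ** S p ** transpose ?A = (?A ** ?B) ** S ?q ** (transpose ?B ** transpose ?A)"
      by (simp only: *(3) matrix_mul_assoc)
    ultimately show "S ?q = ?A ** S p ** transpose ?A"
      by (simp add: AB)
  qed

  (* In a chart c, the fundamental fields and the right inverse W of e' are smooth vector fields, so
     the reconstruction formulas express the triple through smooth functions. *)
  have smooth: "smooth_on (snd c ` fst c) (\<lambda>x. a' (chart_inv c x)
      (coord_vector AP c (chart_inv c x) v))"
      "smooth_on (snd c ` fst c) (\<lambda>x. e' (chart_inv c x) (coord_vector AP c (chart_inv c x) v))"
      "smooth_on (snd c ` fst c) (\<lambda>x. S (chart_inv c x))" if c: "c \<in> AP" for c v
  proof -
    let ?U = "snd c ` fst c" and ?T = "\<lambda>x. coord_vector AP c (chart_inv c x)"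
    note U = chart_domain[OF c]
    note coord = linear_coord_vector[OF AP c] surj_coord_vector[OF AP c]
    have x: "chart_inv c x \<in> fst c" "snd c (chart_inv c x) = x" if "x \<in> ?U" for x
      using chart_chart_inv[OF valid_chartP[OF c] that] by auto
    have Vx: "fund_frame (chart_inv c x) k = ?T x (fund_coord c (X k) x)" if "x \<in> ?U" for x k
      using fundamental_in_chart[OF c x(1)[OF that], of "X k"] x(2)[OF that] by
          (simp add: fund_frame_def)
    note \<psi>_smooth = three_form_along[OF \<psi>3 c] and \<omega>_smooth = two_form_along[OF \<omega>2 c]
      and V_smooth = smooth_on_fund_coord[OF c]
    have e_eq: "e' (chart_inv c x) u $ k = \<psi> (chart_inv c x) u (?T x (fund_coord c (X (k + 1)) x))
        (?T x (fund_coord c (X (k + 2)) x))"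
      if "x \<in> ?U" for x u k
      using rec_solder[OF coframe, of "chart_inv c x"] unfolding \<psi>[symmetric]
      by (simp add: rec_solder_def fun_eq_iff vec_eq_iff Vx[OF that])
    have e_smooth: "smooth_on ?U (\<lambda>x. e' (chart_inv c x) (?T x v))" for v
    proof (rule smooth_on_vec[OF U])
      show "smooth_on ?U (\<lambda>x. e' (chart_inv c x) (?T x v) $ k)" for k
        by (rule smooth_on_cong[OF U e_eq[symmetric]]) (simp_all add: \<psi>_smooth V_smooth smooth_on_const)
    qed
    then show "smooth_on ?U (\<lambda>x. e' (chart_inv c x) (?T x v))" .
    define W where "W j x = right_inverse (\<lambda>v. e' (chart_inv c x) (?T x v)) j" for j x
    have L: "linear (\<lambda>v. e' (chart_inv c x) (?T x v))" "surj (\<lambda>v. e' (chart_inv c x) (?T x v))"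
        if "x \<in> ?U" for x
      using linear_compose[OF coord(1)[OF x(1)[OF that]] lin(2)]
          comp_surj[OF coord(2)[OF x(1)[OF that]] surj]
      by (simp_all add: o_def)
    have W_smooth: "smooth_on ?U (W j)" for j
      unfolding W_def[abs_def] by (rule smooth_on_right_inverse[OF U e_smooth L])
    have eW: "e' (chart_inv c x) (?T x (W j x)) = axis j 1" if "x \<in> ?U" for x j
      using right_inverse[OF L[OF that]] by (simp add: W_def)
    have S_eq: "S (chart_inv c x) = adj3 (\<chi> i j. \<omega> (chart_inv c x) (?T x (fund_coord c (X i) x))
        (?T x (W j x)))"
      if "x \<in> ?U" for x
      using rec_metric[OF coframe, of "chart_inv c x" "\<lambda>j. ?T x (W j x)"] eW[OF that]
      by (simp add: rec_metric_def Vx[OF that] flip: \<omega>)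
    have "smooth_on ?U (\<lambda>x. adj3 (\<chi> i j. \<omega> (chart_inv c x) (?T x (fund_coord c (X i) x))
        (?T x (W j x))))"
      by (intro smooth_on_adj3[OF U] smooth_on_vec[OF U]) (simp add: \<omega>_smooth V_smooth W_smooth)
    then show "smooth_on ?U (\<lambda>x. S (chart_inv c x))"
      by (rule smooth_on_cong[OF U S_eq[symmetric], rotated])
    have a_eq: "a' (chart_inv c x) (?T x v) =
        (let \<Psi> = \<lambda>u v w. \<psi> (chart_inv c x) (?T x u) (?T x v) (?T x w);
        N = (\<lambda>k. fund_coord c (X k) x); Wx = (\<lambda>k. W k x); q = (\<lambda>i. \<Psi> (N i) (Wx (i + 1)) (Wx (i + 2)));
        ev = e' (chart_inv c x) (?T x v) in
      \<chi> k. \<Psi> (N (k + 1)) (Wx (k + 2)) v + ev $ (k + 2) * \<Psi> (N (k + 2)) (Wx (k + 2)) (Wx (k + 1))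
         - ev $ k * ((q k + q (k + 1) - q (k + 2)) * (1 / 2)))" if "x \<in> ?U" for x
      using rec_connection[OF coframe, of "chart_inv c x" "\<lambda>j. ?T x (W j x)"] eW[OF that]
          rec_solder[OF coframe, of "chart_inv c x"]
      unfolding \<psi>[symmetric] by (simp add: rec_connection_def fun_eq_iff Vx[OF that] Let_def)
    show "smooth_on ?U (\<lambda>x. a' (chart_inv c x) (?T x v))"
      by (rule smooth_on_cong[OF U a_eq[symmetric]], assumption, unfold Let_def)
        (intro smooth_on_vec[OF U], simp only: vec_lambda_beta,
         intro smooth_on_diff[OF U] smooth_on_add[OF U] smooth_on_mult[OF U] smooth_on_const
             \<psi>_smooth V_smooth W_smooth
           smooth_on_vec_nth[OF U] e_smooth)
  qed

  have "one_form AP a" "one_form AP e"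
    unfolding one_form_def Let_def a_def e_def
    using smooth linear_compose[OF lin(1) linear_from_coords[of X]]
        linear_compose[OF lin(2) linear_from_coords[of X]]
    by (auto simp: o_def linear_from_coords linear_conv_bounded_linear[symmetric]
        intro!: smooth_on_bounded_linear_comp[OF chart_domain, where L = "from_coords X"])
  moreover have "Ad_equivariant G AG AP act a" "Ad_equivariant G AG AP act e"
    unfolding Ad_equivariant_def
    by (metis equiv ca ce coords_Ad from_coords_coords[OF basis])+
  moreover have "a p (fund \<xi> p) = \<xi>" for p \<xi>
  proof -
    have "a' p (fund \<xi> p) = coords X \<xi>"
      using basis_expansion[of "coords X \<xi>"]
      by (simp add: fund_eq_sum linear_sum[OF lin(1)] linear_scale[OF lin(1)] Va scalar_mult_eq_scaleR)
    then show ?thesis by (simp add: a_def from_coords_coords[OF basis])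
  qed
  moreover have "e p u = 0" if "u \<in> vertical AP AM \<pi> p" for p u
  proof -
    have "\<psi> p u (fund_frame p i) (fund_frame p j) = 0" for i j
      using inv that fund_frame_vertical unfolding invariant_slag_structure_def by blast
    then have "e' p u = 0"
      using fun_cong[OF rec_solder[OF coframe, of p], of u] unfolding \<psi>[symmetric]
      by (simp add: rec_solder_def vec_eq_iff)
    then show ?thesis by (simp add: e_def linear_0[OF linear_from_coords])
  qed
  moreover have "\<exists>u v w. wedge111 (component X e 1 p) (component X e 2 p) (component X e 3 p) u v w
      \<noteq> 0" for p
  proof -
    have "component X e k p = (\<lambda>u. e' p u $ k)" for k
      by (simp add: fun_eq_iff component_def flip: ce) (simp add: coords_def)
    then show ?thesis
      using surj[of p] unfolding surj_iff_triple_product[OF lin(2)] by (simp add: wedge111_eq_cross3)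
  qed
  moreover have "smooth_map AP model_atlas S"
    using smooth_map_model_iff[OF AP] smooth(3) by blast
  ultimately have "is_triple e a S"
    unfolding is_triple_def solder_form_def connection_form_def equivariant_metric_def Let_def
    using pos equiv(3) by blast
  moreover have "\<omega> = triple_omega X e a S" "\<psi> = triple_psi X e a S"
    by (simp_all add: fun_eq_iff triple_forms_eq ca ce \<omega> \<psi>)
  ultimately show ?thesis by blast
qed

lemma triple_unique:
  assumes "is_triple e a S" "is_triple e' a' S'"
    and "triple_omega X e a S = triple_omega X e' a' S'" "triple_psi X e a S = triple_psi X e' a' S'"
  shows "e = e' \<and> a = a' \<and> S = S'"
proof -
  have eq: "(\<lambda>u. coords X (a p u)) = (\<lambda>u. coords X (a' p u)) \<and> (\<lambda>u. coords X (e p u))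
      = (\<lambda>u. coords X (e' p u)) \<and> S p = S' p" for p
    by (rule coframe_triple_unique[OF is_triple_coframe[OF assms(1)] is_triple_coframe[OF assms(2)]])
      (simp_all only: assms(3,4) flip: triple_forms_eq)
  have "a p u = a' p u" "e p u = e' p u" for p u
    using fun_cong[OF conjunct1[OF eq[of p]], of u]
        fun_cong[OF conjunct1[OF conjunct2[OF eq[of p]]], of u]
    by (metis from_coords_coords[OF basis])+
  then show ?thesis using eq by (simp add: fun_eq_iff)
qed

end

theorem theorem3p5:
  fixes G :: "'g::{t2_space, second_countable_topology} monoid"
    and AG :: "('g, real^3) chart set"
    and AP :: "('p::{t2_space, second_countable_topology}, real^6) chart set"
    and AM :: "('m::{t2_space, second_countable_topology}, real^3) chart set"
    and \<pi> :: "'p \<Rightarrow> 'm"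
    and act :: "'p \<Rightarrow> 'g \<Rightarrow> 'p"
    and X :: "3 \<Rightarrow> real^3"
  assumes "lie_group G AG"
    and "connected (UNIV :: 'g set)"
    and "unimodular G AG"
    and "is_basis X"
    and "principal_bundle G AG AP AM \<pi> act"
  shows "bij_betw (\<lambda>(e, a, S). (triple_omega X e a S, triple_psi X e a S))
    {(e, a, S). solder_form G AG AP AM \<pi> act X e \<and> connection_form G AG AP act a \<and>
       equivariant_metric G AG AP act X S}
    {(\<omega>, \<psi>). invariant_slag_structure AP AM \<pi> act \<omega> \<psi> \<and>
       fibres_oriented_by G AG AP act X \<omega> \<psi>}"
proof -
  interpret unimodular_principal_bundle G AG AP AM \<pi> act X
    using assms by unfold_locales
  let ?forms = "\<lambda>(e, a, S). (triple_omega X e a S, triple_psi X e a S)"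
  have "inj_on ?forms {(e, a, S). is_triple e a S}"
    using triple_unique by (auto simp: inj_on_def)
  moreover have "?forms ` {(e, a, S). is_triple e a S} =
    {(\<omega>, \<psi>). invariant_slag_structure AP AM \<pi> act \<omega> \<psi> \<and> fibres_oriented_by G AG AP act X \<omega> \<psi>}"
    (is "_ = ?structures")
  proof (intro equalityI subsetI)
    fix z assume "z \<in> ?forms ` {(e, a, S). is_triple e a S}"
    then show "z \<in> ?structures"
      using triple_structure by auto
  next
    fix z assume "z \<in> ?structures"
    then obtain \<omega> \<psi> where z: "z = (\<omega>, \<psi>)" and "invariant_slag_structure AP AM \<pi> act \<omega> \<psi>"
      "fibres_oriented_by G AG AP act X \<omega> \<psi>" by blast
    then obtain e a S where "is_triple e a S" "\<omega> = triple_omega X e a S" "\<psi> = triple_psi X e a S"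
      using structure_is_triple by blast
    then show "z \<in> ?forms ` {(e, a, S). is_triple e a S}"
      by (intro image_eqI[where x = "(e, a, S)"]) (simp_all add: z)
  qed
  ultimately show ?thesis
    by (simp add: bij_betw_def is_triple_def)
qed

end
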